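(* For every constant $\varepsilon>0$ there are constants $\gamma(\varepsilon),\gamma'(\varepsilon),\gamma''(\varepsilon)>0$ depending only on $\varepsilon$ such that for every fixed integer $d\ge3$: if $G$ is a uniformly random $d$-regular graph on $n$ vertices with adjacency matrix $A_G$, then with probability $1-o_n(1)$ there is a degree-2 Boolean pseudoexpectation $\tilde{\mathbb{E}}$ with $\tilde{\mathbb{E}}[x^{\top}(-A_G)x]\ge(1-2\varepsilon-o_n(1))\,2\sqrt{d-1}\,n$ whose pseudomoment matrix $\mathcal{M}$ satisfies: (1) every row of $\mathcal{M}$ has $\ell_2$ norm at most $\gamma(\varepsilon)$; (2) $\|\mathcal{M}\|_2\le\gamma'(\varepsilon)$; (3) every off-diagonal entry of $\mathcal{M}$ has magnitude at most $\gamma''(\varepsilon)/\sqrt d$.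
   Context: A degree-2 Boolean pseudoexpectation on variables $x=(x_v)_{v\in V}$ is a linear functional $\tilde{\mathbb{E}}$ on multilinear polynomials of degree at most 2 with $\tilde{\mathbb{E}}[1]=1$, $\tilde{\mathbb{E}}[x_v^2]=1$, and $\tilde{\mathbb{E}}[p^2]\ge0$ for every polynomial $p$ of degree at most 1 (squares reduced using $x_v^2=1$). Its pseudomoment matrix $\mathcal{M}$ is indexed by subsets of $V$ of size at most 1, with $\mathcal{M}[S,T]=\tilde{\mathbb{E}}[\prod_{v\in S\Delta T}x_v]$; it is positive semidefinite. $n$ ranges over values with $dn$ even. *)

theory Defs
  imports "HOL-Probability.Probability"
begin

text \<open>A multilinear polynomial is encoded by its coefficients: \<open>p S\<close> is the coefficient of
  the monomial \<open>\<Prod>v\<in>S. x\<^sub>v\<close>.\<close>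

type_synonym 'v mlpoly = "'v set \<Rightarrow> real"

definition mlpolys :: "'v set \<Rightarrow> nat \<Rightarrow> 'v mlpoly set" where
  "mlpolys V k = {p. \<forall>S. p S \<noteq> 0 \<longrightarrow> S \<subseteq> V \<and> card S \<le> k}"

definition mlmonom :: "'v set \<Rightarrow> 'v mlpoly" where
  "mlmonom S = (\<lambda>T. if T = S then 1 else 0)"

text \<open>Multiplication modulo \<open>x\<^sub>v\<^sup>2 = 1\<close>, under which the product of the monomials of \<open>S\<close>
  and \<open>T\<close> is the monomial of their symmetric difference.\<close>

definition mlmult :: "'v set \<Rightarrow> 'v mlpoly \<Rightarrow> 'v mlpoly \<Rightarrow> 'v mlpoly" where
  "mlmult V p q = (\<lambda>U. \<Sum>S\<in>Pow V. \<Sum>T\<in>Pow V. if sym_diff S T = U then p S * q T else 0)"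

text \<open>The functional is only constrained on polynomials of degree at most 2; its values
  elsewhere are irrelevant.\<close>

definition pseudoexpectation2 :: "'v set \<Rightarrow> ('v mlpoly \<Rightarrow> real) \<Rightarrow> bool" where
  "pseudoexpectation2 V E \<longleftrightarrow>
     (\<forall>p\<in>mlpolys V 2. \<forall>q\<in>mlpolys V 2. E (\<lambda>S. p S + q S) = E p + E q) \<and>
     (\<forall>c. \<forall>p\<in>mlpolys V 2. E (\<lambda>S. c * p S) = c * E p) \<and>
     E (mlmonom {}) = 1 \<and>
     (\<forall>v\<in>V. E (mlmult V (mlmonom {v}) (mlmonom {v})) = 1) \<and>
     (\<forall>p\<in>mlpolys V 1. E (mlmult V p p) \<ge> 0)"

definition small_subsets :: "'v set \<Rightarrow> 'v set set" where
  "small_subsets V = {S. S \<subseteq> V \<and> card S \<le> 1}"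

definition pseudomoment_matrix :: "('v mlpoly \<Rightarrow> real) \<Rightarrow> 'v set \<Rightarrow> 'v set \<Rightarrow> real" where
  "pseudomoment_matrix E S T = E (mlmonom (sym_diff S T))"

definition quad_poly :: "'v set \<Rightarrow> ('v \<Rightarrow> 'v \<Rightarrow> real) \<Rightarrow> 'v mlpoly" where
  "quad_poly V B = (\<lambda>U. \<Sum>u\<in>V. \<Sum>v\<in>V. B u v * mlmult V (mlmonom {u}) (mlmonom {v}) U)"

definition spectral_norm :: "'i set \<Rightarrow> ('i \<Rightarrow> 'i \<Rightarrow> real) \<Rightarrow> real" where
  "spectral_norm I M = (SUP f\<in>{f. L2_set f I \<le> 1}. L2_set (\<lambda>i. \<Sum>j\<in>I. M i j * f j) I)"

text \<open>A simple graph on the vertex set \<open>{..<n}\<close> is identified with its set of edges.\<close>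

definition regular_graphs :: "nat \<Rightarrow> nat \<Rightarrow> nat set set set" where
  "regular_graphs n d =
     {G. G \<subseteq> {e. e \<subseteq> {..<n} \<and> card e = 2} \<and> (\<forall>v<n. card {e\<in>G. v \<in> e} = d)}"

definition adj_matrix :: "'v set set \<Rightarrow> 'v \<Rightarrow> 'v \<Rightarrow> real" where
  "adj_matrix G u v = (if {u, v} \<in> G then 1 else 0)"

end

theory Submission
  imports Defs "HOL-Computational_Algebra.Polynomial"
begin

text \<open>
  Let \<open>q\<close> be a bump function with values in \<open>[0, 1]\<close> supported on \<open>x \<le> - (1 - \<epsilon>) 2 \<surd>(d - 1)\<close>. The
  matrix \<open>q(A)\<close> is positive semidefinite of norm at most \<open>1\<close>, and \<open>tr (- A q(A))\<close> is at least
  \<open>(1 - \<epsilon>) 2 \<surd>(d - 1) tr q(A)\<close>. All but \<open>O(1)\<close> vertices (in expectation) of a random \<open>d\<close>-regular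
  graph have no short cycle nearby, and at such a vertex the diagonal entry of \<open>q(A)\<close> is
  approximately the integral of \<open>q\<close> against the Kesten-McKay measure of the \<open>d\<close>-regular tree, which
  is bounded below independently of \<open>d\<close>. Dividing by this integral and replacing the rows and columns
  of the exceptional vertices by those of the identity gives the pseudomoment matrix.

  To avoid spectral theory, \<open>q\<close> is replaced by a Bernstein polynomial \<open>p\<close> on \<open>[-d, d]\<close>: then \<open>p\<close> and
  \<open>1 - p\<close> are nonnegative combinations of the products \<open>(d + x)\<^sup>i (d - x)\<^sup>j\<close>, which are positive
  semidefinite at \<open>A\<close> because \<open>d + A\<close> and \<open>d - A\<close> are. With a polynomial the local computations
  are exact: they are carried out in the basis of the nonbacktracking polynomials, which are
  orthogonal for the Kesten-McKay measure. The exceptional vertices are counted by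
  switching edges, directly in the uniform model.
\<close>

section \<open>Polynomials of a symmetric matrix and the Bernstein cone\<close>

text \<open>The constants have to be uniform in \<open>d\<close>, while \<open>n\<close> tends to
  infinity with \<open>d\<close> fixed. So the degree of \<open>p\<close> and the bound on the
  number of bad vertices may depend on \<open>d\<close>; only the lower bound \<open>m\<close> on
  the Kesten-McKay integral of \<open>p\<close> may not. It is uniform because the bump is a fixed
  function of x / (2 sqrt (d - 1)) and the rescaled density has a lower bound free of
  \<open>d\<close>. The single number 1 / \<open>m\<close> then serves for all three constants,
  since p(A) has norm at most 1 and off-diagonal entries at most 1 / sqrt d in good rows. The
  interval is [-d, d] rather than the bulk [-2 sqrt (d - 1), 2 sqrt (d - 1)], so no bound on the
  nontrivial eigenvalues enters: an eigenvalue outside the bulk is harmless as long as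
  \<open>p\<close> has values in [0, 1] there. One half of the loss 2 \<epsilon> comes from the
  support of the bump, the other from replacing the bump by a polynomial. For fixed \<open>d\<close>
  every bad vertex costs O(1), and Markov's inequality bounds their number by sqrt n; this is the
  o(1) term.\<close>

primrec mpow :: "nat \<Rightarrow> (nat \<Rightarrow> nat \<Rightarrow> real) \<Rightarrow> nat \<Rightarrow> nat \<Rightarrow> nat \<Rightarrow> real" where
  "mpow n A 0 = (\<lambda>u v. if u = v then 1 else 0)"
| "mpow n A (Suc i) = (\<lambda>u v. \<Sum>w<n. A u w * mpow n A i w v)"

definition pmat :: "nat \<Rightarrow> (nat \<Rightarrow> nat \<Rightarrow> real) \<Rightarrow> real poly \<Rightarrow> nat \<Rightarrow> nat \<Rightarrow> real" where
  "pmat n A p u v = (\<Sum>i\<le>degree p. coeff p i * mpow n A i u v)"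

definition qform :: "nat \<Rightarrow> (nat \<Rightarrow> nat \<Rightarrow> real) \<Rightarrow> (nat \<Rightarrow> real) \<Rightarrow> real" where
  "qform n M f = (\<Sum>u<n. \<Sum>v<n. f u * M u v * f v)"

lemma pmat_eq:
  assumes "degree p \<le> N"
  shows "pmat n A p u v = (\<Sum>i\<le>N. coeff p i * mpow n A i u v)"
  unfolding pmat_def using assms
  by (intro sum.mono_neutral_left) (auto simp: coeff_eq_0)

lemma pmat_0 [simp]: "pmat n A 0 u v = 0"
  by (simp add: pmat_def)

lemma pmat_1 [simp]: "pmat n A 1 u v = (if u = v then 1 else 0)"
  by (simp add: pmat_def)

lemma pmat_add [simp]: "pmat n A (p + q) u v = pmat n A p u v + pmat n A q u v"
proof -
  let ?N = "max (degree p) (degree q)"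
  show ?thesis
    by (simp add: pmat_eq[of p ?N] pmat_eq[of q ?N] pmat_eq[of "p + q" ?N] degree_add_le_max
        algebra_simps sum.distrib)
qed

lemma pmat_smult [simp]: "pmat n A (smult c p) u v = c * pmat n A p u v"
  by (simp add: pmat_eq[of "smult c p" "degree p"] pmat_eq[of p "degree p"] sum_distrib_left mult.assoc)

lemma pmat_uminus [simp]: "pmat n A (- p) u v = - pmat n A p u v"
  using pmat_smult[of n A "-1" p u v] by simp

lemma pmat_diff [simp]: "pmat n A (p - q) u v = pmat n A p u v - pmat n A q u v"
  using pmat_add[of n A p "- q" u v] by simp

lemma pmat_sum: "pmat n A (\<Sum>i\<in>I. p i) u v = (\<Sum>i\<in>I. pmat n A (p i) u v)"
  by (induction I rule: infinite_finite_induct) auto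

lemma pmat_pCons:
  "pmat n A (pCons a p) u v = (if u = v then a else 0) + (\<Sum>w<n. A u w * pmat n A p w v)"
proof -
  have "pmat n A (pCons a p) u v =
      (\<Sum>i\<le>Suc (degree p). coeff (pCons a p) i * mpow n A i u v)"
    by (intro pmat_eq) (simp add: degree_pCons_le)
  also have "\<dots> = (if u = v then a else 0) + (\<Sum>i\<le>degree p. coeff p i * (\<Sum>w<n. A u w * mpow n A i w v))"
    by (simp add: sum.atMost_Suc_shift del: sum.atMost_Suc)
  also have "(\<Sum>i\<le>degree p. coeff p i * (\<Sum>w<n. A u w * mpow n A i w v)) =
      (\<Sum>w<n. A u w * pmat n A p w v)"
    unfolding pmat_def sum_distrib_left by (subst sum.swap) (simp add: mult_ac)
  finally show ?thesis .
qed

text \<open>Sums run over indices below \<open>n\<close>, but \<open>mpow\<close> has a diagonal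
  entry at every index; \<open>u < n\<close> makes a constant act as a multiple of the
  identity.\<close>

lemma pmat_mult:
  assumes "u < n"
  shows "pmat n A (p * q) u v = (\<Sum>w<n. pmat n A p u w * pmat n A q w v)"
  using assms
proof (induction p arbitrary: u)
  case 0
  then show ?case by simp
next
  case (pCons a p)
  have "pmat n A (pCons a p * q) u v =
      a * pmat n A q u v + (\<Sum>x<n. A u x * (\<Sum>w<n. pmat n A p x w * pmat n A q w v))"
    using pCons by (simp add: pmat_pCons)
  also have "(\<Sum>x<n. A u x * (\<Sum>w<n. pmat n A p x w * pmat n A q w v)) =
      (\<Sum>w<n. (\<Sum>x<n. A u x * pmat n A p x w) * pmat n A q w v)"
    unfolding sum_distrib_left sum_distrib_right by (subst sum.swap) (simp add: mult_ac)
  also have "a * pmat n A q u v = (\<Sum>w<n. (if u = w then a else 0) * pmat n A q w v)"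
    using pCons.prems by (simp add: if_distrib[of "\<lambda>x. x * _"] cong: if_cong)
  finally show ?case
    by (simp add: pmat_pCons sum.distrib distrib_right)
qed

lemma pmat_X:
  assumes "v < n"
  shows "pmat n A [:0, 1:] u v = A u v"
  using assms by (simp add: pmat_pCons if_distrib[of "\<lambda>x. _ * x"] cong: if_cong)

text \<open>\<open>pmat_pCons\<close> peels a factor A off on the left only. Transposing moves it to
  the right, and commutativity of polynomial multiplication brings it back.\<close>

lemma pmat_sym:
  assumes sym: "\<And>u v. A u v = A v u" and "u < n" "v < n"
  shows "pmat n A p u v = pmat n A p v u"
  using assms(2,3)
proof (induction p arbitrary: u v)
  case 0
  then show ?case by simp
next
  case (pCons a p)
  have "(\<Sum>w<n. A u w * pmat n A p w v) = (\<Sum>w<n. pmat n A p v w * A w u)"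
    using pCons by (intro sum.cong) (auto simp: sym[of u] mult.commute)
  also have "\<dots> = pmat n A (p * [:0, 1:]) v u"
    using pCons.prems by (simp add: pmat_mult pmat_X del: mult_pCons_right)
  also have "\<dots> = pmat n A ([:0, 1:] * p) v u"
    by (simp only: mult.commute)
  also have "\<dots> = (\<Sum>w<n. A v w * pmat n A p w u)"
    using pCons.prems by (subst pmat_mult) (auto simp: pmat_X simp del: mult_pCons_left)
  finally show ?case by (auto simp: pmat_pCons)
qed

section \<open>Quadratic forms of matrix polynomials\<close>

lemma qform_pmat_add: "qform n (pmat n A (p + q)) f = qform n (pmat n A p) f + qform n (pmat n A q) f"
  by (simp add: qform_def sum.distrib algebra_simps)

lemma qform_pmat_smult: "qform n (pmat n A (smult c p)) f = c * qform n (pmat n A p) f"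
  by (simp add: qform_def sum_distrib_left algebra_simps)

lemma qform_pmat_1: "qform n (pmat n A 1) f = (\<Sum>u<n. (f u)\<^sup>2)"
  by (simp add: qform_def power2_eq_square if_distrib[of "\<lambda>x. _ * x"] if_distrib[of "\<lambda>x. x * _"] cong: if_cong)

lemma pmat_mult_apply:
  assumes "u < n"
  shows "(\<Sum>v<n. pmat n A (p * q) u v * f v) = (\<Sum>w<n. pmat n A p u w * (\<Sum>v<n. pmat n A q w v * f v))"
  using assms unfolding sum_distrib_left
  by (subst sum.swap) (simp add: pmat_mult sum_distrib_left sum_distrib_right mult_ac)

lemma pmat_self_adjoint:
  assumes sym: "\<And>u v. A u v = A v u"
  shows "(\<Sum>u<n. f u * (\<Sum>v<n. pmat n A p u v * g v)) = (\<Sum>v<n. (\<Sum>u<n. pmat n A p v u * f u) * g v)"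
proof -
  have "(\<Sum>u<n. f u * (\<Sum>v<n. pmat n A p u v * g v)) = (\<Sum>v<n. \<Sum>u<n. f u * pmat n A p u v * g v)"
    unfolding sum_distrib_left by (subst sum.swap) (simp add: mult_ac)
  also have "\<dots> = (\<Sum>v<n. \<Sum>u<n. f u * pmat n A p v u * g v)"
    by (intro sum.cong refl) (simp add: pmat_sym[OF sym])
  finally show ?thesis by (simp add: sum_distrib_left sum_distrib_right mult_ac)
qed

lemma qform_eq: "qform n M f = (\<Sum>u<n. f u * (\<Sum>v<n. M u v * f v))"
  by (simp add: qform_def sum_distrib_left mult.assoc)

text \<open>r(A) is self-adjoint, so the outer factor moves to the other argument: (f, r s r f) = (r
  f, s r f). Hence conjugation preserves positive semidefiniteness, which takes the place of
  diagonalisation.\<close>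

lemma qform_conj:
  assumes sym: "\<And>u v. A u v = A v u"
  shows "qform n (pmat n A (r * (s * r))) f = qform n (pmat n A s) (\<lambda>u. \<Sum>v<n. pmat n A r u v * f v)"
proof -
  have "qform n (pmat n A (r * (s * r))) f =
      (\<Sum>u<n. f u * (\<Sum>v<n. pmat n A r u v * (\<Sum>w<n. pmat n A (s * r) v w * f w)))"
    unfolding qform_eq by (intro sum.cong refl) (simp add: pmat_mult_apply)
  also have "\<dots> = (\<Sum>v<n. (\<Sum>u<n. pmat n A r v u * f u) * (\<Sum>w<n. pmat n A (s * r) v w * f w))"
    by (rule pmat_self_adjoint[OF sym])
  also have "\<dots> = qform n (pmat n A s) (\<lambda>u. \<Sum>v<n. pmat n A r u v * f v)"
    unfolding qform_eq by (intro sum.cong refl) (simp add: pmat_mult_apply)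
  finally show ?thesis .
qed

lemma qform_square:
  assumes sym: "\<And>u v. A u v = A v u"
  shows "qform n (pmat n A (r * r)) f = (\<Sum>u<n. (\<Sum>v<n. pmat n A r u v * f v)\<^sup>2)"
  using qform_conj[OF sym, where r = r and s = 1 and f = f and n = n] by (simp add: qform_pmat_1)

text \<open>The generators are, up to positive factors, the Bernstein basis polynomials of all
  degrees on [-D, D]. Membership certifies nonnegativity on the interval in a way that survives the
  substitution of a matrix.\<close>

inductive_set bernstein_cone :: "real \<Rightarrow> real poly set" for D :: real where
  basis: "c \<ge> 0 \<Longrightarrow> smult c ([:D, 1:] ^ i * [:D, -1:] ^ j) \<in> bernstein_cone D"
| add: "p \<in> bernstein_cone D \<Longrightarrow> q \<in> bernstein_cone D \<Longrightarrow> p + q \<in> bernstein_cone D"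

lemma bernstein_cone_0: "0 \<in> bernstein_cone D"
  using bernstein_cone.basis[of 0 D 0 0] by simp

lemma bernstein_cone_sum:
  "(\<And>i. i \<in> I \<Longrightarrow> p i \<in> bernstein_cone D) \<Longrightarrow> (\<Sum>i\<in>I. p i) \<in> bernstein_cone D"
  by (induction I rule: infinite_finite_induct) (auto intro: bernstein_cone.add bernstein_cone_0)

lemma bernstein_cone_mult:
  assumes "p \<in> bernstein_cone D" "q \<in> bernstein_cone D"
  shows "p * q \<in> bernstein_cone D"
  using assms(1)
proof induction
  case (basis c i j)
  show ?case using assms(2)
  proof induction
    case (basis c' i' j')
    have "smult c ([:D, 1:] ^ i * [:D, -1:] ^ j) * smult c' ([:D, 1:] ^ i' * [:D, -1:] ^ j') =
      smult (c * c') ([:D, 1:] ^ (i + i') * [:D, -1:] ^ (j + j'))"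
      by (simp add: power_add mult_ac)
    also have "\<dots> \<in> bernstein_cone D"
      using basis \<open>c \<ge> 0\<close> by (intro bernstein_cone.basis) auto
    finally show ?case .
  next
    case (add p q)
    then show ?case by (simp only: distrib_left) (rule bernstein_cone.add)
  qed
next
  case (add p q)
  then show ?case by (simp only: distrib_right) (rule bernstein_cone.add)
qed

lemma bernstein_cone_poly_nonneg:
  assumes "p \<in> bernstein_cone D" "\<bar>x\<bar> \<le> D"
  shows "poly p x \<ge> 0"
  using assms by induction auto

text \<open>Up to squares only the products of at most one factor of each kind remain, and
  \<open>2 D (D - x) (D + x) = (D - x)\<^sup>2 (D + x) + (D + x)\<^sup>2 (D - x)\<close>.\<close>

lemma bernstein_cone_psd:
  assumes sym: "\<And>u v. A u v = A v u" and D: "D > 0"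
    and plus: "\<And>f. qform n (pmat n A [:D, 1:]) f \<ge> 0"
    and minus: "\<And>f. qform n (pmat n A [:D, -1:]) f \<ge> 0"
    and p: "p \<in> bernstein_cone D"
  shows "qform n (pmat n A p) f \<ge> 0"
proof -
  define psd where "psd = (\<lambda>p. \<forall>f. qform n (pmat n A p) f \<ge> 0)"
  have conj: "psd (r * (s * r))" if "psd s" for r s
    using that by (simp add: psd_def qform_conj[OF sym])
  have one: "psd 1"
    by (simp add: psd_def qform_pmat_1 sum_nonneg)
  have P: "psd [:D, 1:]" and M: "psd [:D, -1:]"
    using plus minus by (auto simp: psd_def)
  have "smult (2 * D) ([:D, 1:] * [:D, -1:]) =
      [:D, 1:] * ([:D, -1:] * [:D, 1:]) + [:D, -1:] * ([:D, 1:] * [:D, -1:])"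
    by (simp add: algebra_simps)
  moreover have "psd ([:D, 1:] * ([:D, -1:] * [:D, 1:]) + [:D, -1:] * ([:D, 1:] * [:D, -1:]))"
    using conj[OF P] conj[OF M] unfolding psd_def qform_pmat_add by (simp only: add_nonneg_nonneg simp_thms)
  ultimately have "psd (smult (2 * D) ([:D, 1:] * [:D, -1:]))"
    by (simp only:)
  then have PM: "psd ([:D, 1:] * [:D, -1:])"
    using D unfolding psd_def qform_pmat_smult by (simp add: zero_le_mult_iff)
  have pow: "psd ([:D, 1:] ^ i * [:D, -1:] ^ j)" for i j
  proof -
    let ?r = "[:D, 1:] ^ (i div 2) * [:D, -1:] ^ (j div 2)"
    let ?s = "[:D, 1:] ^ (i mod 2) * [:D, -1:] ^ (j mod 2)"
    have "i mod 2 = 0 \<or> i mod 2 = 1" "j mod 2 = 0 \<or> j mod 2 = 1"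
      by auto
    then have "psd ?s"
      using one P M PM by (elim disjE) simp_all
    moreover have "[:D, 1:] ^ i = [:D, 1:] ^ (i div 2) * [:D, 1:] ^ (i mod 2) * [:D, 1:] ^ (i div 2)"
      unfolding power_add[symmetric] by (rule arg_cong[where f = "\<lambda>k. _ ^ k"]) presburger
    moreover have "[:D, -1:] ^ j = [:D, -1:] ^ (j div 2) * [:D, -1:] ^ (j mod 2) * [:D, -1:] ^ (j div 2)"
      unfolding power_add[symmetric] by (rule arg_cong[where f = "\<lambda>k. _ ^ k"]) presburger
    ultimately have "[:D, 1:] ^ i * [:D, -1:] ^ j = ?r * (?s * ?r)"
      by (simp only: mult_ac)
    with conj[OF \<open>psd ?s\<close>, of ?r] show ?thesis by (simp only:)
  qed
  from p have "psd p"
  proof induction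
    case (basis c i j)
    then show ?case using pow[of i j] unfolding psd_def qform_pmat_smult by simp
  next
    case (add p q)
    then show ?case unfolding psd_def qform_pmat_add by simp
  qed
  then show ?thesis by (simp add: psd_def)
qed

text \<open>\<open>p (1 - p)\<close> also lies in the cone, hence \<open>p(A)\<^sup>2 \<le> p(A) \<le> 1\<close>.\<close>

lemma bernstein_cone_contraction:
  assumes sym: "\<And>u v. A u v = A v u" and D: "D > 0"
    and plus: "\<And>f. qform n (pmat n A [:D, 1:]) f \<ge> 0"
    and minus: "\<And>f. qform n (pmat n A [:D, -1:]) f \<ge> 0"
    and p: "p \<in> bernstein_cone D" "1 - p \<in> bernstein_cone D"
  shows "(\<Sum>u<n. (\<Sum>v<n. pmat n A p u v * f v)\<^sup>2) \<le> (\<Sum>u<n. (f u)\<^sup>2)"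
proof -
  note psd = bernstein_cone_psd[OF sym D plus minus]
  have "qform n (pmat n A p) f = qform n (pmat n A (p * p + p * (1 - p))) f"
    by (simp add: algebra_simps)
  moreover have "qform n (pmat n A 1) f = qform n (pmat n A (p + (1 - p))) f"
    by simp
  ultimately show ?thesis
    using psd[OF bernstein_cone_mult[OF p], of f] psd[OF p(2), of f]
    unfolding qform_pmat_add qform_square[OF sym] qform_pmat_1 by simp
qed

text \<open>\<open>B k\<close> is a Bernstein basis polynomial in the variable (x + D) / (2 D), and
  the coefficients of \<open>p\<close> are sample values of \<open>f\<close>, hence lie in [0, 1].
  As the basis sums to 1, the coefficients of 1 - \<open>p\<close> are the numbers 1 -
  \<open>c k\<close>, again nonnegative.\<close>

lemma bernstein_cone_approx:
  fixes f :: "real \<Rightarrow> real"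
  assumes D: "D > 0" and e: "e > 0" and cont: "continuous_on {-D..D} f"
    and f01: "\<And>x. \<bar>x\<bar> \<le> D \<Longrightarrow> 0 \<le> f x \<and> f x \<le> 1"
  obtains p where "p \<in> bernstein_cone D" "1 - p \<in> bernstein_cone D"
    "\<And>x. \<bar>x\<bar> \<le> D \<Longrightarrow> \<bar>f x - poly p x\<bar> < e"
proof -
  define g where "g t = f (2 * D * t - D)" for t
  have "continuous_on {0..1} (f \<circ> (\<lambda>t. 2 * D * t - D))"
  proof (rule continuous_on_compose)
    have "(\<lambda>t. 2 * D * t - D) ` {0..1} \<subseteq> {-D..D}"
      using D by (auto simp: mult_le_cancel_left)
    then show "continuous_on ((\<lambda>t. 2 * D * t - D) ` {0..1}) f"
      by (rule continuous_on_subset[OF cont])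
  qed (intro continuous_intros)
  then have "continuous_on {0..1} g"
    by (simp add: g_def o_def)
  from Bernstein_Weierstrass[OF this e]
  obtain N where N: "\<And>x. x \<in> {0..1} \<Longrightarrow> \<bar>g x - (\<Sum>k\<le>N. g (k / N) * Bernstein N k x)\<bar> < e"
    by (metis order_refl)
  define c where "c k = g (k / N)" for k :: nat
  have c01: "0 \<le> c k \<and> c k \<le> 1" if "k \<le> N" for k
  proof -
    have "0 \<le> real k / N" "real k / N \<le> 1"
      using that by (auto simp: divide_le_eq_1)
    then have "\<bar>2 * D * (real k / N) - D\<bar> \<le> D"
      using D mult_left_mono[of "real k / N" 1 "2 * D"] by (simp add: abs_le_iff)
    then show ?thesis using f01 by (simp add: c_def g_def)
  qed
  define B where "B k = smult (real (N choose k) / (2 * D) ^ N) ([:D, 1:] ^ k * [:D, -1:] ^ (N - k))" for k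
  have polyB: "poly (B k) x = Bernstein N k ((x + D) / (2 * D))" if "k \<le> N" for k x
  proof -
    have "1 - (x + D) / (2 * D) = (D - x) / (2 * D)"
      using D by (simp add: field_simps)
    moreover have "(2 * D) ^ N = (2 * D) ^ k * (2 * D) ^ (N - k)"
      using that by (metis power_add le_add_diff_inverse)
    ultimately show ?thesis
      by (simp add: B_def Bernstein_def power_divide poly_power add.commute)
  qed
  define p where "p = (\<Sum>k\<le>N. smult (c k) (B k))"
  have "(\<Sum>k\<le>N. B k) = 1"
  proof (rule poly_eq_poly_eq_iff[THEN iffD1])
    show "poly (\<Sum>k\<le>N. B k) = poly 1"
    proof
      fix x
      have "poly (\<Sum>k\<le>N. B k) x = (\<Sum>k\<le>N. Bernstein N k ((x + D) / (2 * D)))"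
        by (simp add: poly_sum polyB)
      then show "poly (\<Sum>k\<le>N. B k) x = poly 1 x"
        by (simp add: sum_Bernstein)
    qed
  qed
  then have "1 - p = (\<Sum>k\<le>N. smult (1 - c k) (B k))"
    by (simp add: p_def smult_diff_left sum_subtractf)
  moreover have cone: "smult a (B k) \<in> bernstein_cone D" if "a \<ge> 0" for a k
    using D that unfolding B_def smult_smult by (intro bernstein_cone.basis) auto
  ultimately have "p \<in> bernstein_cone D" "1 - p \<in> bernstein_cone D"
    using c01 by (auto simp: p_def intro!: bernstein_cone_sum cone)
  moreover have "\<bar>f x - poly p x\<bar> < e" if "\<bar>x\<bar> \<le> D" for x
  proof -
    have "(x + D) / (2 * D) \<in> {0..1}"
      using D that by (auto simp: field_simps abs_le_iff)
    from N[OF this] show ?thesis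
      using D by (simp add: g_def p_def poly_sum polyB c_def)
  qed
  ultimately show ?thesis using that by blast
qed

section \<open>Nonbacktracking walks in regular graphs\<close>

text \<open>\<open>x\<close> is the vertex visited just before \<open>u\<close>, to which the next
  step must not return. \<open>nb_walks\<close> has no such predecessor, so its first step is
  free.\<close>

primrec nb_walks_from :: "('v \<Rightarrow> 'v set) \<Rightarrow> nat \<Rightarrow> 'v \<Rightarrow> 'v \<Rightarrow> 'v \<Rightarrow> nat" where
  "nb_walks_from N 0 x u v = of_bool (u = v)"
| "nb_walks_from N (Suc k) x u v = (\<Sum>w\<in>N u - {x}. nb_walks_from N k u w v)"

definition nb_walks :: "('v \<Rightarrow> 'v set) \<Rightarrow> nat \<Rightarrow> 'v \<Rightarrow> 'v \<Rightarrow> nat" where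
  "nb_walks N k u v = (case k of 0 \<Rightarrow> of_bool (u = v) | Suc k \<Rightarrow> (\<Sum>w\<in>N u. nb_walks_from N k u w v))"

text \<open>The Geronimus polynomials: at the adjacency operator of the D-regular tree, index k
  gives the indicator of distance k. The factor D at the first step and D - 1 afterwards counts the
  immediate returns.\<close>

fun nb_poly :: "real \<Rightarrow> nat \<Rightarrow> real poly" where
  "nb_poly D 0 = 1"
| "nb_poly D (Suc 0) = [:0, 1:]"
| "nb_poly D (Suc (Suc k)) = [:0, 1:] * nb_poly D (Suc k) - smult (if k = 0 then D else D - 1) (nb_poly D k)"

text \<open>Keeping the path from a bad vertex to the short cycle allows a single switching, at the closing
  edge \<open>{w ! m, w ! i}\<close>, to bound the number of bad vertices.\<close>

definition lollipops :: "nat \<Rightarrow> nat set set \<Rightarrow> nat \<Rightarrow> (nat list \<times> nat) set" where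
  "lollipops n G m = {(w, i). length w = Suc m \<and> set w \<subseteq> {..<n} \<and> distinct w \<and>
     successively (\<lambda>x y. {x, y} \<in> G) w \<and> Suc (Suc i) \<le> m \<and> {w ! m, w ! i} \<in> G}"

definition bad_vertices :: "nat \<Rightarrow> nat set set \<Rightarrow> nat \<Rightarrow> nat set" where
  "bad_vertices n G M = {u. u < n \<and> (\<exists>m\<le>M. \<exists>(w, i)\<in>lollipops n G m. hd w = u)}"

definition nbrs :: "'v set set \<Rightarrow> 'v \<Rightarrow> 'v set" where
  "nbrs G u = {v. {u, v} \<in> G}"

lemma nbrs_iff [simp]: "v \<in> nbrs G u \<longleftrightarrow> {u, v} \<in> G"
  by (simp add: nbrs_def)

lemma adj_matrix_sym: "adj_matrix G u v = adj_matrix G v u"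
  by (simp add: adj_matrix_def insert_commute)

section \<open>Counting nonbacktracking walks in a regular graph\<close>

locale regular_graph =
  fixes n d :: nat and G :: "nat set set"
  assumes G: "G \<in> regular_graphs n d"
begin

lemma edge_props:
  assumes "{u, v} \<in> G"
  shows "u < n" "v < n" "u \<noteq> v"
proof -
  have "{u, v} \<subseteq> {..<n} \<and> card {u, v} = 2"
    using G assms unfolding regular_graphs_def by blast
  then show "u < n" "v < n" "u \<noteq> v" by auto
qed

lemma nbrs_subset: "nbrs G u \<subseteq> {..<n}"
  using edge_props by auto

lemma finite_nbrs [simp]: "finite (nbrs G u)"
  using nbrs_subset finite_subset by blast

lemma card_nbrs:
  assumes "u < n"
  shows "card (nbrs G u) = d"
proof -
  have "bij_betw (\<lambda>v. {u, v}) (nbrs G u) {e \<in> G. u \<in> e}"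
  proof (rule bij_betwI')
    fix v w assume "v \<in> nbrs G u" "w \<in> nbrs G u"
    then show "({u, v} = {u, w}) = (v = w)" by (auto simp: doubleton_eq_iff)
  next
    fix e assume e: "e \<in> {e \<in> G. u \<in> e}"
    then have "card e = 2"
      using G unfolding regular_graphs_def by blast
    then obtain x y where "e = {x, y}" by (auto simp: card_2_iff)
    with e have "e = {u, if x = u then y else x}" by auto
    with e show "\<exists>v\<in>nbrs G u. e = {u, v}" by (metis nbrs_iff mem_Collect_eq)
  qed auto
  then have "card (nbrs G u) = card {e \<in> G. u \<in> e}"
    by (rule bij_betw_same_card)
  then show ?thesis
    using G assms by (simp add: regular_graphs_def)
qed

lemma sum_adj: "(\<Sum>w<n. adj_matrix G u w * f w) = (\<Sum>w\<in>nbrs G u. f w)"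
proof -
  have "(\<Sum>w<n. adj_matrix G u w * f w) = (\<Sum>w\<in>{..<n} \<inter> nbrs G u. f w)"
    by (simp add: adj_matrix_def sum.inter_restrict if_distrib[of "\<lambda>x. x * _"] cong: if_cong)
  also have "{..<n} \<inter> nbrs G u = nbrs G u" using nbrs_subset by auto
  finally show ?thesis .
qed

abbreviation "nbw \<equiv> nb_walks (nbrs G)"
abbreviation "nbf \<equiv> nb_walks_from (nbrs G)"

lemma nb_walks_split:
  assumes "{u, x} \<in> G"
  shows "nbw (Suc k) u v = nbf (Suc k) x u v + nbf k u x v"
  using assms by (simp add: nb_walks_def sum.remove[of "nbrs G u" x])

text \<open>Prefixing the step from \<open>u\<close> to a neighbour \<open>w\<close> gives a
  nonbacktracking walk of length k + 2 unless the walk from \<open>w\<close> goes straight back to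
  \<open>u\<close>. The rest is then a walk of length k from \<open>u\<close> that does not start
  with \<open>w\<close>, and a given one arises from d - 1 choices of \<open>w\<close>, or from d if
  k = 0. The additive form avoids subtraction of natural numbers.\<close>

lemma nb_walks_rec:
  assumes "u < n"
  shows "(\<Sum>w\<in>nbrs G u. nbw (Suc k) w v) + (if k = 0 then 0 else nbw k u v) =
    nbw (Suc (Suc k)) u v + d * nbw k u v"
proof -
  have "(\<Sum>w\<in>nbrs G u. nbw (Suc k) w v) = (\<Sum>w\<in>nbrs G u. nbf (Suc k) u w v + nbf k w u v)"
    by (intro sum.cong nb_walks_split refl) (auto simp: insert_commute)
  also have "\<dots> = nbw (Suc (Suc k)) u v + (\<Sum>w\<in>nbrs G u. nbf k w u v)"
    unfolding sum.distrib by (simp add: nb_walks_def)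
  finally have 1: "(\<Sum>w\<in>nbrs G u. nbw (Suc k) w v) = nbw (Suc (Suc k)) u v + (\<Sum>w\<in>nbrs G u. nbf k w u v)" .
  show ?thesis
  proof (cases k)
    case 0
    then show ?thesis using 1 card_nbrs[OF assms] by (simp add: nb_walks_def)
  next
    case (Suc j)
    have "(\<Sum>w\<in>nbrs G u. nbf k w u v) + nbw k u v = (\<Sum>w\<in>nbrs G u. nbf k w u v + nbf j u w v)"
      unfolding sum.distrib by (simp add: nb_walks_def Suc)
    also have "\<dots> = (\<Sum>w\<in>nbrs G u. nbw k u v)"
      unfolding Suc by (intro sum.cong refl nb_walks_split[symmetric]) auto
    also have "\<dots> = d * nbw k u v"
      using card_nbrs[OF assms] by simp
    finally show ?thesis using 1 Suc by simp
  qed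
qed

lemma pmat_nb_poly:
  assumes "u < n" "v < n"
  shows "pmat n (adj_matrix G) (nb_poly d k) u v = nbw k u v"
  using assms(1)
proof (induction "real d" k arbitrary: u rule: nb_poly.induct)
  case 1
  then show ?case by (simp add: nb_walks_def)
next
  case 2
  then show ?case using assms(2)
    by (auto simp: nb_walks_def pmat_X adj_matrix_def of_bool_def)
next
  case (3 k)
  have "pmat n (adj_matrix G) ([:0, 1:] * nb_poly d (Suc k)) u v = (\<Sum>w\<in>nbrs G u. real (nbw (Suc k) w v))"
  proof -
    have "pmat n (adj_matrix G) ([:0, 1:] * nb_poly d (Suc k)) u v =
        (\<Sum>w\<in>nbrs G u. pmat n (adj_matrix G) (nb_poly d (Suc k)) w v)"
      by (simp add: pmat_pCons sum_adj)
    also have "\<dots> = (\<Sum>w\<in>nbrs G u. real (nbw (Suc k) w v))"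
      using edge_props 3 by (intro sum.cong refl) auto
    finally show ?thesis .
  qed
  then have "pmat n (adj_matrix G) (nb_poly d (Suc (Suc k))) u v =
      real (\<Sum>w\<in>nbrs G u. nbw (Suc k) w v) - (if k = 0 then real d else real d - 1) * nbw k u v"
    using 3 by (simp del: mult_pCons_left)
  moreover have "real (\<Sum>w\<in>nbrs G u. nbw (Suc k) w v) + real (if k = 0 then 0 else nbw k u v) =
    real (nbw (Suc (Suc k)) u v) + real (d * nbw k u v)"
    using nb_walks_rec[OF 3(3), of k v] by (simp only: of_nat_add[symmetric])
  ultimately show ?case
    by (cases "k = 0") (simp_all add: left_diff_distrib del: nb_poly.simps)
qed

lemma sum_nb_walks_from:
  assumes "{u, x} \<in> G"
  shows "(\<Sum>v<n. nbf k x u v) = (d - 1) ^ k"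
  using assms
proof (induction k arbitrary: u x)
  case 0
  then show ?case using edge_props[OF 0] by (simp add: of_bool_def)
next
  case (Suc k)
  have "(\<Sum>v<n. nbf (Suc k) x u v) = (\<Sum>w\<in>nbrs G u - {x}. \<Sum>v<n. nbf k u w v)"
    unfolding nb_walks_from.simps by (rule sum.swap)
  also have "\<dots> = (\<Sum>w\<in>nbrs G u - {x}. (d - 1) ^ k)"
    by (intro sum.cong refl Suc.IH) (auto simp: insert_commute)
  also have "\<dots> = (d - 1) ^ Suc k"
    using Suc.prems edge_props[OF Suc.prems] card_nbrs[of u] by (simp add: card_Diff_singleton)
  finally show ?case .
qed

lemma sum_nb_walks_Suc:
  assumes "u < n"
  shows "(\<Sum>v<n. nbw (Suc k) u v) = d * (d - 1) ^ k"
proof -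
  have "(\<Sum>v<n. nbw (Suc k) u v) = (\<Sum>w\<in>nbrs G u. \<Sum>v<n. nbf k u w v)"
    unfolding nb_walks_def nat.case by (rule sum.swap)
  also have "\<dots> = (\<Sum>w\<in>nbrs G u. (d - 1) ^ k)"
    by (intro sum.cong refl sum_nb_walks_from) (auto simp: insert_commute)
  finally show ?thesis using card_nbrs[OF assms] by simp
qed

text \<open>A repeated vertex would close a lollipop that starts at \<open>u\<close>. The index of
  \<open>z\<close> on the path is neither the last one, as there are no loops, nor the last but one,
  as the step does not backtrack; so the cycle has length at least 3.\<close>

lemma good_path_no_return:
  assumes u: "u \<notin> bad_vertices n G M" "u < n"
    and w: "distinct w" "successively (\<lambda>x y. {x, y} \<in> G) w" "set w \<subseteq> {..<n}" "hd w = u"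
      "length w = Suc (Suc l)"
    and z: "{w ! Suc l, z} \<in> G" "z \<noteq> w ! l" and l: "Suc l \<le> M"
  shows "z \<notin> set w"
proof
  assume "z \<in> set w"
  then obtain i where i: "i < Suc (Suc l)" "z = w ! i"
    using w(5) by (auto simp: in_set_conv_nth)
  with z edge_props(3)[OF z(1)] have "i < l"
    by (metis less_antisym)
  then have "(w, i) \<in> lollipops n G (Suc l)"
    using w i z by (auto simp: lollipops_def)
  then show False
    using u l w(4) unfolding bad_vertices_def by blast
qed

text \<open>The whole path \<open>w\<close> is carried through the induction because each new vertex
  has to differ from all earlier ones. At least one step is required: with none, \<open>v\<close>
  would be the end of \<open>w\<close>.\<close>

lemma nb_walks_from_leaves_path:
  assumes u: "u \<notin> bad_vertices n G M" "u < n"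
    and w: "distinct w" "successively (\<lambda>x y. {x, y} \<in> G) w" "set w \<subseteq> {..<n}" "hd w = u"
      "length w = Suc (Suc l)"
    and "nbf (Suc k) (w ! l) (w ! Suc l) v > 0" "l + Suc k \<le> M"
  shows "v \<notin> set w"
  using w assms(8,9)
proof (induction k arbitrary: w l)
  case 0
  then have v: "{w ! Suc l, v} \<in> G" "v \<noteq> w ! l"
    by (auto simp: of_bool_def split: if_splits)
  show ?case
    using good_path_no_return[OF u 0(1-5) v] 0 by simp
next
  case (Suc k)
  note w = Suc.prems(1-5)
  have "\<exists>z\<in>nbrs G (w ! Suc l) - {w ! l}. nbf (Suc k) (w ! Suc l) z v > 0"
  proof (rule ccontr)
    assume "\<not> ?thesis"
    then have "nbf (Suc (Suc k)) (w ! l) (w ! Suc l) v = 0"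
      by (subst nb_walks_from.simps(2), intro sum.neutral) (use not_gr_zero in blast)
    with Suc.prems(6) show False by linarith
  qed
  then obtain z where "z \<in> nbrs G (w ! Suc l) - {w ! l}" "nbf (Suc k) (w ! Suc l) z v > 0"
    by blast
  then have z: "{w ! Suc l, z} \<in> G" "z \<noteq> w ! l" "nbf (Suc k) (w ! Suc l) z v > 0"
    by (simp_all del: nb_walks_from.simps)
  have "z \<notin> set w"
    using good_path_no_return[OF u w z(1,2)] Suc.prems by simp
  moreover have "last w = w ! Suc l"
    using w(5) by (cases w) (auto simp: last_conv_nth)
  moreover have "w \<noteq> []" using w(5) by auto
  ultimately have "v \<notin> set (w @ [z])"
    using w z Suc.prems edge_props[OF z(1)]
    by (intro Suc.IH[of _ "Suc l"]) (auto simp: successively_append_iff nth_append)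
  then show ?case by simp
qed

lemma nb_walks_closed:
  assumes u: "u \<notin> bad_vertices n G M" "u < n" and k: "0 < k" "k \<le> M"
  shows "nbw k u u = 0"
proof (rule ccontr)
  assume nz: "nbw k u u \<noteq> 0"
  obtain j where j: "k = Suc j" using k by (cases k) auto
  with nz obtain z where z: "{u, z} \<in> G" "nbf j u z u > 0"
    by (auto simp: nb_walks_def)
  note e = edge_props[OF z(1)]
  show False
  proof (cases j)
    case 0
    then show ?thesis using z e by simp
  next
    case (Suc i)
    have "u \<notin> set [u, z]"
      using z e Suc j k by (intro nb_walks_from_leaves_path[OF u, of _ 0 i]) auto
    then show ?thesis by simp
  qed
qed

text \<open>Twice the form is the sum of \<open>A u v\<close> (f u + c f v)^2 over ordered pairs,
  because every vertex has degree \<open>d\<close> and c^2 = 1.\<close>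

lemma qform_degree_nonneg:
  assumes "c = 1 \<or> c = -1"
  shows "qform n (pmat n (adj_matrix G) [:real d, c:]) f \<ge> 0"
proof -
  define A where "A = adj_matrix G"
  have deg: "(\<Sum>v<n. A u v) = d" if "u < n" for u
    using sum_adj[of u "\<lambda>_. 1"] card_nbrs[OF that] by (simp add: A_def)
  have entry: "pmat n A [:real d, c:] u v = (if u = v then real d else 0) + c * A u v" if "v < n" for u v
    using that by (simp add: pmat_pCons if_distrib[of "\<lambda>x. _ * x"] mult.commute cong: if_cong)
  have "qform n (pmat n A [:real d, c:]) f =
      (\<Sum>u<n. \<Sum>v<n. (if u = v then d * (f u * f u) else 0) + c * A u v * f u * f v)"
    unfolding qform_def by (intro sum.cong refl) (auto simp: entry algebra_simps)
  also have "\<dots> = (\<Sum>u<n. d * (f u)\<^sup>2) + (\<Sum>u<n. \<Sum>v<n. c * A u v * f u * f v)"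
    by (simp add: sum.distrib power2_eq_square)
  finally have 1: "qform n (pmat n A [:real d, c:]) f =
      (\<Sum>u<n. d * (f u)\<^sup>2) + (\<Sum>u<n. \<Sum>v<n. c * A u v * f u * f v)" .
  have 2: "(\<Sum>u<n. d * (f u)\<^sup>2) = (\<Sum>u<n. \<Sum>v<n. A u v * (f u)\<^sup>2)"
    by (simp add: deg flip: sum_distrib_right)
  have 3: "(\<Sum>u<n. \<Sum>v<n. A u v * (f u)\<^sup>2) = (\<Sum>u<n. \<Sum>v<n. A u v * (f v)\<^sup>2)"
    by (subst sum.swap, intro sum.cong refl) (simp add: A_def adj_matrix_def insert_commute)
  have "0 \<le> (\<Sum>u<n. \<Sum>v<n. A u v * (f u + c * f v)\<^sup>2)"
    by (intro sum_nonneg mult_nonneg_nonneg) (auto simp: A_def adj_matrix_def)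
  also have "\<dots> = (\<Sum>u<n. \<Sum>v<n. A u v * (f u)\<^sup>2 + A u v * (f v)\<^sup>2 + 2 * (c * A u v * f u * f v))"
    using assms by (intro sum.cong refl) (auto simp: power2_eq_square algebra_simps)
  also have "\<dots> = 2 * qform n (pmat n A [:real d, c:]) f"
    unfolding 1 2 using 3 by (simp add: sum.distrib flip: sum_distrib_left)
  finally show ?thesis by (simp add: A_def)
qed

end

section \<open>The Kesten-McKay measure\<close>

lemma nb_poly_coeff: "coeff (nb_poly D k) k = 1 \<and> (\<forall>i>k. coeff (nb_poly D k) i = 0)"
proof (induction D k rule: nb_poly.induct)
  case (3 D k)
  have "coeff (nb_poly D (Suc (Suc k))) i = 0" if "i > Suc (Suc k)" for i
    using 3 that by (cases i) auto
  then show ?case using 3 by auto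
qed (auto simp: coeff_pCons split: nat.splits)

lemma degree_nb_poly: "degree (nb_poly D k) \<le> k"
  by (rule degree_le) (use nb_poly_coeff in blast)

lemma nb_poly_expansion:
  assumes "degree p \<le> M"
  obtains c where "p = (\<Sum>k\<le>M. smult (c k) (nb_poly D k))"
proof -
  have "\<exists>c. p = (\<Sum>k\<le>M. smult (c k) (nb_poly D k))"
    using assms
  proof (induction M arbitrary: p)
    case 0
    then obtain a where "p = [:a:]" by (auto elim: degree_eq_zeroE)
    then show ?case by (intro exI[of _ "\<lambda>_. a"]) simp
  next
    case (Suc M)
    let ?a = "coeff p (Suc M)"
    have "degree (p - smult ?a (nb_poly D (Suc M))) \<le> M"
    proof (rule degree_le, intro allI impI)
      fix i assume "M < i"
      then show "coeff (p - smult ?a (nb_poly D (Suc M))) i = 0"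
        using nb_poly_coeff[of D "Suc M"] Suc.prems
        by (cases "i = Suc M") (auto simp: coeff_eq_0)
    qed
    from Suc.IH[OF this] obtain c
      where "p - smult ?a (nb_poly D (Suc M)) = (\<Sum>k\<le>M. smult (c k) (nb_poly D k))" by blast
    then have "p = (\<Sum>k\<le>Suc M. smult ((c(Suc M := ?a)) k) (nb_poly D k))"
      by (simp add: algebra_simps)
    then show ?case by blast
  qed
  then show ?thesis using that by blast
qed

text \<open>The Kesten-McKay density after the substitution \<open>x = 2 \<surd>(D - 1) cos \<theta>\<close>. The denominator is
  \<open>\<bar>1 - t e\<^bsup>2i\<theta>\<^esup>\<bar>\<^sup>2\<close> with \<open>t = 1 / (D - 1)\<close>.\<close>

definition km_weight :: "real \<Rightarrow> real \<Rightarrow> real" where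
  "km_weight D \<theta> = 2 / pi * (1 + 1 / (D - 1)) * (sin \<theta>)\<^sup>2 /
     (1 - 2 / (D - 1) * cos (2 * \<theta>) + (1 / (D - 1))\<^sup>2)"

definition km :: "real \<Rightarrow> (real \<Rightarrow> real) \<Rightarrow> real" where
  "km D f = integral {0..pi} (\<lambda>\<theta>. f (2 * sqrt (D - 1) * cos \<theta>) * km_weight D \<theta>)"

text \<open>The expression lies between (1 - |t|)^2 and (1 + |t|)^2. The assumption on
  \<open>t\<close> corresponds to t = 1 / (D - 1) with D at least 3.\<close>

lemma km_denominator_bounds:
  fixes t x :: real
  assumes "\<bar>t\<bar> \<le> 1 / 2"
  shows "1 / 4 \<le> 1 - 2 * t * cos x + t\<^sup>2" "1 - 2 * t * cos x + t\<^sup>2 \<le> (1 + \<bar>t\<bar>)\<^sup>2"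
proof -
  have "\<bar>t * cos x\<bar> \<le> \<bar>t\<bar> * 1"
    unfolding abs_mult by (intro mult_left_mono) auto
  then have *: "t * cos x \<le> \<bar>t\<bar>" "- \<bar>t\<bar> \<le> t * cos x" by auto
  have "(1 / 2)\<^sup>2 \<le> (1 - \<bar>t\<bar>)\<^sup>2"
    using assms by (intro power_mono) auto
  then show "1 / 4 \<le> 1 - 2 * t * cos x + t\<^sup>2"
    using * by (simp add: power2_eq_square algebra_simps)
  show "1 - 2 * t * cos x + t\<^sup>2 \<le> (1 + \<bar>t\<bar>)\<^sup>2"
    using * by (simp add: power2_eq_square algebra_simps)
qed

text \<open>With s = sqrt (D - 1) and U the Chebyshev polynomials of the second kind, the identity
  reads s^(k+1) (U_(k+1) - U_(k-1) / s^2); both sides satisfy the recurrence with coefficient s^2.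
  It starts at index 1 because at index 0 the right side would be 1 + 1 / (D - 1) times too
  large.\<close>

lemma nb_poly_chebyshev:
  assumes "D > 1"
  shows "poly (nb_poly D (Suc k)) (2 * sqrt (D - 1) * cos \<theta>) * sin \<theta> =
    sqrt (D - 1) ^ Suc k * (sin ((real k + 2) * \<theta>) - 1 / (D - 1) * sin (real k * \<theta>))"
proof -
  define s where "s = sqrt (D - 1)"
  have s: "s > 0" "D = s\<^sup>2 + 1" using assms by (auto simp: s_def)
  define S where "S k = s ^ Suc k * (sin ((real k + 2) * \<theta>) - 1 / s\<^sup>2 * sin (real k * \<theta>))" for k
  have S_rec: "S (Suc (Suc k)) = 2 * s * cos \<theta> * S (Suc k) - s\<^sup>2 * S k" for k
  proof -
    have "sin ((real k + 4) * \<theta>) + sin ((real k + 2) * \<theta>) = 2 * cos \<theta> * sin ((real k + 3) * \<theta>)"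
      using sin_add[of "(real k + 3) * \<theta>" \<theta>] sin_diff[of "(real k + 3) * \<theta>" \<theta>]
      by (simp add: algebra_simps)
    moreover have "sin ((real k + 2) * \<theta>) + sin (real k * \<theta>) = 2 * cos \<theta> * sin ((real k + 1) * \<theta>)"
      using sin_add[of "(real k + 1) * \<theta>" \<theta>] sin_diff[of "(real k + 1) * \<theta>" \<theta>]
      by (simp add: algebra_simps)
    ultimately have *: "sin ((real k + 4) * \<theta>) = 2 * cos \<theta> * sin ((real k + 3) * \<theta>) - sin ((real k + 2) * \<theta>)"
      "sin ((real k + 2) * \<theta>) = 2 * cos \<theta> * sin ((real k + 1) * \<theta>) - sin (real k * \<theta>)"
      by linarith+
    have "S (Suc (Suc k)) = s ^ (k + 3) * (sin ((real k + 4) * \<theta>) - 1 / s\<^sup>2 * sin ((real k + 2) * \<theta>))"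
      by (simp add: S_def power3_eq_cube power_add algebra_simps)
    also have "\<dots> = s ^ (k + 3) * (2 * cos \<theta> * sin ((real k + 3) * \<theta>) - sin ((real k + 2) * \<theta>)
        - 1 / s\<^sup>2 * (2 * cos \<theta> * sin ((real k + 1) * \<theta>) - sin (real k * \<theta>)))"
      using * by metis
    also have "\<dots> = 2 * s * cos \<theta> * S (Suc k) - s\<^sup>2 * S k"
      using s(1) by (simp add: S_def power3_eq_cube power2_eq_square power_add field_simps)
    finally show ?thesis .
  qed
  have "poly (nb_poly (s\<^sup>2 + 1) (Suc k)) (2 * s * cos \<theta>) * sin \<theta> = S k"
  proof (induction k rule: induct_nat_012)
    case 0
    then show ?case by (simp add: S_def sin_double)
  next
    case 1
    have "sin (3 * \<theta>) = 4 * (cos \<theta>)\<^sup>2 * sin \<theta> - sin \<theta>"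
    proof -
      have "sin (3 * \<theta>) = sin (2 * \<theta> + \<theta>)" by simp
      also have "\<dots> = 2 * sin \<theta> * cos \<theta> * cos \<theta> + (2 * (cos \<theta>)\<^sup>2 - 1) * sin \<theta>"
        by (simp only: sin_add sin_double cos_double_cos)
      finally show ?thesis by (simp add: power2_eq_square algebra_simps)
    qed
    then have "S (Suc 0) = s\<^sup>2 * (4 * (cos \<theta>)\<^sup>2 * sin \<theta> - sin \<theta>) - sin \<theta>"
      using s(1) by (simp add: S_def power2_eq_square right_diff_distrib)
    then show ?case by (simp add: power2_eq_square algebra_simps)
  next
    case (ge2 k)
    let ?P = "\<lambda>k. poly (nb_poly (s\<^sup>2 + 1) k) (2 * s * cos \<theta>) * sin \<theta>"
    have "?P (Suc (Suc (Suc k))) = 2 * s * cos \<theta> * ?P (Suc (Suc k)) - s\<^sup>2 * ?P (Suc k)"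
      by (subst nb_poly.simps(3)) (simp add: algebra_simps del: nb_poly.simps)
    also have "\<dots> = S (Suc (Suc k))"
      unfolding ge2 S_rec ..
    finally show ?case .
  qed
  moreover have "D - 1 = s\<^sup>2" using s by simp
  ultimately show ?thesis
    unfolding S_def s(2)[symmetric] s_def[symmetric] by (simp only:)
qed

lemma integral_sin_sin:
  "integral {0..pi} (\<lambda>\<theta>. sin \<theta> * sin ((real k + 1) * \<theta>)) = (if k = 0 then pi / 2 else 0)"
proof (cases "k = 0")
  case True
  have "((\<lambda>\<theta>. sin \<theta> * sin \<theta>) has_integral ((pi - sin (2 * pi) / 2) / 2 - (0 - sin (2 * 0) / 2) / 2)) {0..pi}"
    by (intro fundamental_theorem_of_calculus)
      (auto intro!: derivative_eq_intros simp flip: has_real_derivative_iff_has_vector_derivative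
        simp: cos_double_sin power2_eq_square diff_divide_distrib)
  with True show ?thesis by (simp add: integral_unique)
next
  case False
  define F where "F \<theta> = (sin (real k * \<theta>) / real k - sin ((real k + 2) * \<theta>) / (real k + 2)) / 2" for \<theta>
  have F: "F pi = 0" "F 0 = 0"
    using sin_npi[of k] sin_npi[of "k + 2"] by (auto simp: F_def algebra_simps)
  have "((\<lambda>\<theta>. (cos (real k * \<theta>) - cos ((real k + 2) * \<theta>)) / 2) has_integral (F pi - F 0)) {0..pi}"
    using False unfolding F_def
    by (intro fundamental_theorem_of_calculus)
      (auto intro!: derivative_eq_intros simp flip: has_real_derivative_iff_has_vector_derivative)
  moreover have "sin \<theta> * sin ((real k + 1) * \<theta>) = (cos (real k * \<theta>) - cos ((real k + 2) * \<theta>)) / 2" for \<theta>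
    using cos_add[of "(real k + 1) * \<theta>" \<theta>] cos_diff[of "(real k + 1) * \<theta>" \<theta>]
    by (simp add: algebra_simps)
  ultimately have "((\<lambda>\<theta>. sin \<theta> * sin ((real k + 1) * \<theta>)) has_integral (F pi - F 0)) {0..pi}"
    by (simp only:)
  then show ?thesis
    using F False by (simp add: integral_unique)
qed

text \<open>The functions \<open>g\<^sub>k(\<theta>) = sin((k+1)\<theta>) - t sin((k-1)\<theta>)\<close> satisfy
  \<open>g\<^sub>k - t g\<^bsub>k+2\<^esub> = sin((k+1)\<theta>) (1 - 2 t cos 2\<theta> + t\<^sup>2)\<close>. Dividing by the denominator and iterating,
  the integral is \<open>t ^ j\<close> times a bounded quantity for all \<open>j\<close>.\<close>

lemma integral_chebyshev:
  fixes t :: real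
  assumes t: "0 \<le> t" "t \<le> 1 / 2"
  shows "integral {0..pi} (\<lambda>\<theta>. sin \<theta> * (sin ((real k + 1) * \<theta>) - t * sin ((real k - 1) * \<theta>)) /
    (1 - 2 * t * cos (2 * \<theta>) + t\<^sup>2)) = (if k = 0 then pi / 2 else 0)"
proof -
  define den where "den \<theta> = 1 - 2 * t * cos (2 * \<theta>) + t\<^sup>2" for \<theta>
  define h where "h k \<theta> = sin \<theta> * (sin ((real k + 1) * \<theta>) - t * sin ((real k - 1) * \<theta>)) / den \<theta>"
    for k :: nat and \<theta>
  define J where "J k = integral {0..pi} (h k)" for k
  have den: "den \<theta> \<ge> 1 / 4" for \<theta>
    using km_denominator_bounds(1)[of t "2 * \<theta>"] t by (simp add: den_def)
  have den_nz: "den \<theta> \<noteq> 0" for \<theta> using den[of \<theta>] by linarith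
  have cont: "continuous_on {0..pi} (h k)" for k
    unfolding h_def using den_nz unfolding den_def by (intro continuous_intros) auto
  note integrable = integrable_continuous_real[OF cont]
  have step: "J k = t * J (k + 2) + (if k = 0 then pi / 2 else 0)" for k
  proof -
    have "h k \<theta> - t * h (k + 2) \<theta> = sin \<theta> * sin ((real k + 1) * \<theta>)" for \<theta>
    proof -
      have "sin ((real k + 3) * \<theta>) + sin ((real k - 1) * \<theta>) = 2 * cos (2 * \<theta>) * sin ((real k + 1) * \<theta>)"
        using sin_add[of "(real k + 1) * \<theta>" "2 * \<theta>"] sin_diff[of "(real k + 1) * \<theta>" "2 * \<theta>"]
        by (simp add: algebra_simps)
      then have s3: "sin ((real k + 3) * \<theta>) = 2 * cos (2 * \<theta>) * sin ((real k + 1) * \<theta>) - sin ((real k - 1) * \<theta>)"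
        by linarith
      have "h k \<theta> - t * h (k + 2) \<theta> =
        sin \<theta> * ((sin ((real k + 1) * \<theta>) - t * sin ((real k - 1) * \<theta>)) -
          t * (sin ((real k + 3) * \<theta>) - t * sin ((real k + 1) * \<theta>))) / den \<theta>"
      proof -
        have "h (k + 2) \<theta> = sin \<theta> * (sin ((real k + 3) * \<theta>) - t * sin ((real k + 1) * \<theta>)) / den \<theta>"
          by (simp add: h_def add.commute)
        then show ?thesis
          by (simp add: h_def right_diff_distrib diff_divide_distrib mult_ac)
      qed
      also have "\<dots> = sin \<theta> * (sin ((real k + 1) * \<theta>) * den \<theta>) / den \<theta>"
        unfolding s3 by (simp add: den_def power2_eq_square algebra_simps)
      finally show ?thesis using den_nz by simp
    qed
    then have "integral {0..pi} (\<lambda>\<theta>. h k \<theta> - t * h (k + 2) \<theta>) = (if k = 0 then pi / 2 else 0)"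
      by (simp only: integral_sin_sin)
    moreover have "integral {0..pi} (\<lambda>\<theta>. h k \<theta> - t * h (k + 2) \<theta>) = J k - t * J (k + 2)"
      unfolding J_def by (subst integral_diff) (auto intro: integrable integrable_on_mult_right)
    ultimately show ?thesis by simp
  qed
  \<comment> \<open>The numerator is at most 2 in absolute value and the denominator at least 1 /
    4.\<close>
  have bound: "\<bar>J k\<bar> \<le> 8 * pi" for k
  proof -
    have "norm (J k) \<le> 8 * (pi - 0)"
      unfolding J_def
    proof (rule integral_bound)
      fix \<theta>
      have "\<bar>sin \<theta> * (sin ((real k + 1) * \<theta>) - t * sin ((real k - 1) * \<theta>))\<bar> \<le> 1 * (1 + 1 * 1)"
        unfolding abs_mult
      proof (intro mult_mono)
        have "\<bar>t * sin ((real k - 1) * \<theta>)\<bar> \<le> 1 * 1"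
          unfolding abs_mult using t by (intro mult_mono) auto
        then show "\<bar>sin ((real k + 1) * \<theta>) - t * sin ((real k - 1) * \<theta>)\<bar> \<le> 1 + 1 * 1"
          using abs_sin_le_one[of "(real k + 1) * \<theta>"] by linarith
      qed auto
      then have "\<bar>h k \<theta>\<bar> \<le> 2 / (1 / 4)"
        unfolding h_def abs_divide using den[of \<theta>] by (intro frac_le) auto
      then show "norm (h k \<theta>) \<le> 8" by simp
    qed (auto intro: cont)
    then show ?thesis by simp
  qed
  have zero: "J k = 0" if "k > 0" for k
  proof -
    have iter: "J k = t ^ j * J (k + 2 * j)" for j
      using that by (induction j) (auto simp: step[of "k + 2 * j" for j])
    have "\<bar>J k\<bar> \<le> t ^ j * (8 * pi)" for j
      using t bound[of "k + 2 * j"] by (subst iter[of j]) (auto simp: abs_mult intro!: mult_left_mono)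
    moreover have "(\<lambda>j. t ^ j * (8 * pi)) \<longlonglongrightarrow> 0"
      using t by (intro tendsto_mult_left_zero LIMSEQ_power_zero) auto
    ultimately have "\<bar>J k\<bar> \<le> 0"
      using LIMSEQ_le_const by blast
    then show ?thesis by simp
  qed
  have "J k = (if k = 0 then pi / 2 else 0)"
    using step[of k] zero[of "k + 2"] zero[of k] by auto
  then show ?thesis unfolding J_def h_def den_def .
qed

text \<open>The lower bound is free of \<open>D\<close>, and so is the constant of
  \<open>test_polynomial\<close> derived from it. It comes from 2 / pi \<ge> 1 / 2 and (1 + t) / (1
  + t)^2 \<ge> 2 / 3 for t \<le> 1 / 2, whose product 1 / 3 exceeds 1 / 4.\<close>

lemma km_weight_bounds:
  assumes "D \<ge> 3"
  shows "(sin \<theta>)\<^sup>2 / 4 \<le> km_weight D \<theta>" "0 \<le> km_weight D \<theta>"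
proof -
  define t where "t = 1 / (D - 1)"
  have t: "0 \<le> t" "t \<le> 1 / 2" using assms by (auto simp: t_def field_simps)
  define den where "den = 1 - 2 * t * cos (2 * \<theta>) + t\<^sup>2"
  have den: "1 / 4 \<le> den" "den \<le> (1 + t)\<^sup>2"
    using km_denominator_bounds[of t "2 * \<theta>"] t by (auto simp: den_def)
  have w: "km_weight D \<theta> = 2 / pi * ((1 + t) * (sin \<theta>)\<^sup>2 / den)"
    by (simp add: km_weight_def t_def den_def)
  have "(sin \<theta>)\<^sup>2 * (2 / 3) \<le> (sin \<theta>)\<^sup>2 * (1 / (1 + t))"
    using t by (intro mult_left_mono) (auto simp: field_simps)
  also have "\<dots> = (1 + t) * (sin \<theta>)\<^sup>2 / (1 + t)\<^sup>2"
    using t by (simp add: power2_eq_square)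
  also have "\<dots> \<le> (1 + t) * (sin \<theta>)\<^sup>2 / den"
    using t den by (intro divide_left_mono mult_nonneg_nonneg mult_pos_pos) auto
  finally have *: "(sin \<theta>)\<^sup>2 * (2 / 3) \<le> (1 + t) * (sin \<theta>)\<^sup>2 / den" .
  have "(sin \<theta>)\<^sup>2 / 4 \<le> 1 / 2 * ((sin \<theta>)\<^sup>2 * (2 / 3))" by simp
  also have "\<dots> \<le> 2 / pi * ((1 + t) * (sin \<theta>)\<^sup>2 / den)"
    using * pi_less_4 by (intro mult_mono) (auto simp: field_simps)
  finally show "(sin \<theta>)\<^sup>2 / 4 \<le> km_weight D \<theta>" by (simp add: w)
  then show "0 \<le> km_weight D \<theta>"
    by (rule order_trans[rotated]) simp
qed

lemma continuous_on_km_weight: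
  assumes "D \<ge> 3"
  shows "continuous_on S (km_weight D)"
proof -
  have "1 - 2 / (D - 1) * cos (2 * \<theta>) + (1 / (D - 1))\<^sup>2 \<noteq> 0" for \<theta>
  proof -
    have "1 / 4 \<le> 1 - 2 * (1 / (D - 1)) * cos (2 * \<theta>) + (1 / (D - 1))\<^sup>2"
      by (rule km_denominator_bounds(1)) (use assms in \<open>auto simp: field_simps\<close>)
    then show ?thesis by auto
  qed
  then show ?thesis
    unfolding km_weight_def by (intro continuous_intros) auto
qed

lemma km_arg_bound: "D \<ge> 3 \<Longrightarrow> \<bar>2 * sqrt (D - 1) * cos \<theta>\<bar> \<le> D"
proof -
  assume D: "D \<ge> 3"
  have "\<bar>2 * sqrt (D - 1) * cos \<theta>\<bar> \<le> 2 * sqrt (D - 1) * 1"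
    unfolding abs_mult using D by (intro mult_mono) auto
  also have "\<dots> \<le> D"
  proof -
    have "0 \<le> (sqrt (D - 1) - 1)\<^sup>2" by simp
    then show ?thesis using D by (simp add: power2_diff)
  qed
  finally show ?thesis .
qed

lemma km_integrable:
  assumes "D \<ge> 3" "continuous_on {-D..D} f"
  shows "(\<lambda>\<theta>. f (2 * sqrt (D - 1) * cos \<theta>) * km_weight D \<theta>) integrable_on {0..pi}"
proof (intro integrable_continuous_real continuous_on_mult continuous_on_km_weight assms)
  have "continuous_on ((\<lambda>\<theta>. 2 * sqrt (D - 1) * cos \<theta>) ` {0..pi}) f"
    using km_arg_bound[OF assms(1)] by (intro continuous_on_subset[OF assms(2)]) (auto simp: abs_le_iff minus_le_iff)
  then show "continuous_on {0..pi} (\<lambda>\<theta>. f (2 * sqrt (D - 1) * cos \<theta>))"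
    by (rule continuous_on_compose2) (auto intro!: continuous_intros)
qed

section \<open>The Kesten-McKay integral as a functional on polynomials\<close>

lemma km_mono:
  assumes D: "D \<ge> 3" and cont: "continuous_on {-D..D} f" "continuous_on {-D..D} g"
    and le: "\<And>x. \<bar>x\<bar> \<le> D \<Longrightarrow> f x \<le> g x"
  shows "km D f \<le> km D g"
  unfolding km_def
  by (intro integral_le km_integrable D cont mult_right_mono le km_arg_bound km_weight_bounds)

lemma km_add:
  assumes "D \<ge> 3" "continuous_on {-D..D} f" "continuous_on {-D..D} g"
  shows "km D (\<lambda>x. f x + g x) = km D f + km D g"
  unfolding km_def distrib_right by (intro integral_add km_integrable assms)

lemma km_cmult: "km D (\<lambda>x. c * f x) = c * km D f"
  unfolding km_def mult.assoc by (rule integral_mult_right)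

lemma km_poly_add: "D \<ge> 3 \<Longrightarrow> km D (poly (p + q)) = km D (poly p) + km D (poly q)"
  using km_add[of D "poly p" "poly q"] by (simp add: poly_add[abs_def] continuous_intros)

lemma km_poly_smult: "km D (poly (smult c p)) = c * km D (poly p)"
  using km_cmult[of D c "poly p"] by (simp add: poly_smult[abs_def])

lemma km_poly_diff: "D \<ge> 3 \<Longrightarrow> km D (poly (p - q)) = km D (poly p) - km D (poly q)"
  using km_poly_add[of D p "smult (-1) q"] km_poly_smult[of D "-1" q] by simp

lemma km_0 [simp]: "km D (\<lambda>_. 0) = 0" "km D (poly 0) = 0"
  by (simp_all add: km_def)

lemma km_poly_sum:
  "D \<ge> 3 \<Longrightarrow> km D (poly (\<Sum>i\<in>I. p i)) = (\<Sum>i\<in>I. km D (poly (p i)))"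
  by (induction I rule: infinite_finite_induct) (auto simp: km_poly_add)

lemma km_nb_poly:
  assumes D: "D \<ge> 3"
  shows "km D (poly (nb_poly D k)) = (if k = 0 then 1 else 0)"
proof -
  define t where "t = 1 / (D - 1)"
  have t: "0 \<le> t" "t \<le> 1 / 2" using D by (auto simp: t_def field_simps)
  define den where "den \<theta> = 1 - 2 * t * cos (2 * \<theta>) + t\<^sup>2" for \<theta>
  define h where "h \<theta> = sin \<theta> * (sin ((real k + 1) * \<theta>) - t * sin ((real k - 1) * \<theta>)) / den \<theta>" for \<theta>
  \<comment> \<open>For index 0 the factor 1 + t of the weight is already contained in
    \<open>h\<close>, since there sin ((k - 1) \<theta>) = - sin \<theta>; so it is left out of
    \<open>C\<close>.\<close>
  define C where "C = (if k = 0 then 2 / pi else 2 / pi * (1 + t) * sqrt (D - 1) ^ k)"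
  have "poly (nb_poly D k) (2 * sqrt (D - 1) * cos \<theta>) * km_weight D \<theta> = C * h \<theta>" for \<theta>
  proof (cases k)
    case 0
    have "C * h \<theta> = 2 / pi * (1 + t) * (sin \<theta>)\<^sup>2 / den \<theta>"
    proof -
      have "h \<theta> = (1 + t) * (sin \<theta>)\<^sup>2 / den \<theta>"
        using 0 by (simp add: h_def power2_eq_square algebra_simps)
      then show ?thesis using 0 by (simp add: C_def)
    qed
    then show ?thesis using 0 by (simp add: km_weight_def den_def t_def)
  next
    case (Suc j)
    have "poly (nb_poly D k) (2 * sqrt (D - 1) * cos \<theta>) * km_weight D \<theta> =
        (poly (nb_poly D k) (2 * sqrt (D - 1) * cos \<theta>) * sin \<theta>) * (2 / pi * (1 + t) * sin \<theta> / den \<theta>)"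
      by (simp add: km_weight_def den_def t_def power2_eq_square)
    also have "poly (nb_poly D k) (2 * sqrt (D - 1) * cos \<theta>) * sin \<theta> =
        sqrt (D - 1) ^ k * (sin ((real k + 1) * \<theta>) - t * sin ((real k - 1) * \<theta>))"
      using nb_poly_chebyshev[of D j \<theta>] D by (simp add: Suc t_def add.commute del: nb_poly.simps)
    finally show ?thesis using Suc by (simp add: C_def h_def)
  qed
  then have "km D (poly (nb_poly D k)) = integral {0..pi} (\<lambda>\<theta>. C * h \<theta>)"
    by (simp add: km_def)
  also have "\<dots> = C * (if k = 0 then pi / 2 else 0)"
    unfolding integral_mult_right h_def den_def integral_chebyshev[OF t, of k] ..
  finally show ?thesis by (simp add: C_def)
qed

lemma km_1: "D \<ge> 3 \<Longrightarrow> km D (poly 1) = 1"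
  using km_nb_poly[of D 0] by simp

section \<open>Orthogonality of the nonbacktracking polynomials\<close>

lemma X_mult_nb_poly:
  "[:0, 1:] * nb_poly D (Suc k) = nb_poly D (Suc (Suc k)) + smult (if k = 0 then D else D - 1) (nb_poly D k)"
  by simp

text \<open>Each factor X of \<open>p\<close> is moved onto the nonbacktracking polynomial, where
  the three-term recurrence lowers the index by at most one. The index stays positive throughout,
  and \<open>km\<close> vanishes at every positive index.\<close>

lemma km_mult_nb_poly_eq_0:
  assumes D: "D \<ge> 3" and "degree p < k"
  shows "km D (poly (p * nb_poly D k)) = 0"
  using assms(2)
proof (induction p arbitrary: k)
  case 0
  then show ?case by simp
next
  case (pCons a p)
  obtain j where k: "k = Suc j" using pCons.prems by (cases k) auto
  have "pCons a p * nb_poly D k = smult a (nb_poly D k) + p * ([:0, 1:] * nb_poly D k)"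
    by simp
  also have "p * ([:0, 1:] * nb_poly D k) =
      p * nb_poly D (Suc k) + smult (if j = 0 then D else D - 1) (p * nb_poly D j)"
    unfolding k X_mult_nb_poly by (simp only: distrib_left mult_smult_right)
  finally have eq: "pCons a p * nb_poly D k = smult a (nb_poly D k) +
      (p * nb_poly D (Suc k) + smult (if j = 0 then D else D - 1) (p * nb_poly D j))" .
  have "km D (poly (p * nb_poly D (Suc k))) = 0" "km D (poly (p * nb_poly D j)) = 0"
  proof -
    have "p = 0 \<or> degree p < j"
      using pCons.prems k by (cases "p = 0") auto
    then show "km D (poly (p * nb_poly D (Suc k))) = 0" "km D (poly (p * nb_poly D j)) = 0"
      using pCons.IH[of "Suc k"] pCons.IH[of j] k by (auto simp del: nb_poly.simps poly_mult)
  qed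
  then show ?case
    unfolding eq km_poly_add[OF D] km_poly_smult using km_nb_poly[OF D, of k] k
    by (simp del: nb_poly.simps mult_pCons_left)
qed

lemma km_nb_poly_orthogonal:
  assumes D: "D \<ge> 3" and "j \<noteq> k"
  shows "km D (poly (nb_poly D j * nb_poly D k)) = 0"
proof (cases "j < k")
  case True
  then show ?thesis
    using degree_nb_poly[of D j] by (intro km_mult_nb_poly_eq_0 D) auto
next
  case False
  then show ?thesis
    using degree_nb_poly[of D k] assms(2)
    by (subst mult.commute) (intro km_mult_nb_poly_eq_0 D, auto)
qed

text \<open>The value is the number of vertices at distance k + 1 from the root of the tree. For the
  step, one factor of index k + 2 is written as X times the polynomial of index k + 1 plus a lower
  term, and X is given to the other factor; orthogonality leaves D - 1 times the previous
  norm.\<close>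

lemma km_nb_poly_norm:
  assumes D: "D \<ge> 3"
  shows "km D (poly (nb_poly D (Suc k) * nb_poly D (Suc k))) = D * (D - 1) ^ k"
proof (induction k)
  case 0
  have "nb_poly D (Suc 0) * nb_poly D (Suc 0) = nb_poly D 2 + smult D (nb_poly D 0)"
    by (simp add: numeral_2_eq_2)
  then show ?case
    using km_nb_poly[OF D, of 2] km_nb_poly[OF D, of 0]
    by (simp only: km_poly_add[OF D] km_poly_smult) simp
next
  case (Suc k)
  let ?Q = "nb_poly D" and ?c = "if k = 0 then D else D - 1"
  have "?Q (Suc (Suc k)) * ?Q (Suc (Suc k)) =
      ?Q (Suc k) * ([:0, 1:] * ?Q (Suc (Suc k))) - smult ?c (?Q k * ?Q (Suc (Suc k)))"
  proof -
    have "?Q (Suc (Suc k)) * q = ?Q (Suc k) * ([:0, 1:] * q) - smult ?c (?Q k * q)" for q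
      by (simp add: algebra_simps)
    then show ?thesis .
  qed
  also have "?Q (Suc k) * ([:0, 1:] * ?Q (Suc (Suc k))) =
      ?Q (Suc k) * ?Q (Suc (Suc (Suc k))) + smult (D - 1) (?Q (Suc k) * ?Q (Suc k))"
    unfolding X_mult_nb_poly by (simp add: distrib_left del: nb_poly.simps)
  finally show ?case
    using Suc km_nb_poly_orthogonal[OF D, of "Suc k" "Suc (Suc (Suc k))"]
      km_nb_poly_orthogonal[OF D, of k "Suc (Suc k)"]
    by (simp only: km_poly_add[OF D] km_poly_diff[OF D] km_poly_smult) simp
qed

section \<open>The test polynomial and its values at good vertices\<close>

text \<open>\<open>m\<close> is chosen before \<open>D\<close>: in the variable cos \<theta> the
  ramp \<open>h\<close> is the same for all \<open>D\<close>, and the weight is bounded below by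
  (sin \<theta>)^2 / 4. Only the approximating polynomial depends on \<open>D\<close>.\<close>

lemma test_polynomial:
  fixes \<epsilon> :: real
  assumes eps: "0 < \<epsilon>" "\<epsilon> < 1"
  shows "\<exists>m>0. \<forall>D\<ge>3. \<exists>p. p \<in> bernstein_cone D \<and> 1 - p \<in> bernstein_cone D \<and> m \<le> km D (poly p) \<and>
    (1 - 2 * \<epsilon>) * (2 * sqrt (D - 1)) * km D (poly p) \<le> - km D (poly ([:0, 1:] * p))"
proof -
  define h :: "real \<Rightarrow> real" where "h y = min 1 (max 0 (- y - (1 - \<epsilon>)))" for y
  have h: "0 \<le> h y" "h y \<le> 1" "(1 - \<epsilon>) * h y \<le> - y * h y" for y
  proof -
    show "0 \<le> h y" "h y \<le> 1" by (auto simp: h_def)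
    show "(1 - \<epsilon>) * h y \<le> - y * h y"
    proof (cases "1 - \<epsilon> \<le> - y")
      case True
      then show ?thesis using \<open>0 \<le> h y\<close> by (rule mult_right_mono)
    next
      case False
      then have "h y = 0" by (simp add: h_def)
      then show ?thesis by simp
    qed
  qed
  have cont_h: "continuous_on S h" for S
    unfolding h_def by (intro continuous_intros)
  define I where "I = integral {0..pi} (\<lambda>\<theta>. h (cos \<theta>) * ((sin \<theta>)\<^sup>2 / 4))"
  have cont_I: "continuous_on {0..pi} (\<lambda>\<theta>. h (cos \<theta>) * ((sin \<theta>)\<^sup>2 / 4))"
    by (intro continuous_intros continuous_on_compose2[OF cont_h[of UNIV]]) auto
  have "I \<noteq> 0"
  proof
    assume "I = 0"
    then have *: "\<forall>\<theta>\<in>{0..pi}. h (cos \<theta>) * ((sin \<theta>)\<^sup>2 / 4) = 0"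
      unfolding I_def using cont_I h by (subst (asm) integral_eq_0_iff) auto
    \<comment> \<open>A point strictly inside the support of \<open>h\<close> and away from the
      zeros of sin, where the integrand is positive.\<close>
    define \<theta> where "\<theta> = arccos (- (1 - \<epsilon> / 2))"
    have b: "- 1 < - (1 - \<epsilon> / 2)" "- (1 - \<epsilon> / 2) < 1" using eps by auto
    have "\<theta> \<in> {0..pi}" "cos \<theta> = - (1 - \<epsilon> / 2)"
      using b by (auto simp: \<theta>_def arccos_lbound arccos_ubound)
    moreover have "sin \<theta> \<noteq> 0"
    proof
      assume "sin \<theta> = 0"
      then have "(cos \<theta>)\<^sup>2 = 1" using sin_cos_squared_add[of \<theta>] by simp
      then show False using \<open>cos \<theta> = _\<close> b by (auto simp: power2_eq_1_iff)
    qed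
    moreover have "h (- (1 - \<epsilon> / 2)) > 0"
      using eps by (auto simp: h_def min_def max_def)
    ultimately show False using * by force
  qed
  moreover have "I \<ge> 0"
    unfolding I_def using h cont_I by (intro integral_nonneg integrable_continuous_real) auto
  ultimately have I: "I > 0" by simp
  have "\<exists>p. p \<in> bernstein_cone D \<and> 1 - p \<in> bernstein_cone D \<and> I / 2 \<le> km D (poly p) \<and>
    (1 - 2 * \<epsilon>) * (2 * sqrt (D - 1)) * km D (poly p) \<le> - km D (poly ([:0, 1:] * p))" if D: "D \<ge> 3" for D :: real
  proof -
    define \<rho> where "\<rho> = 2 * sqrt (D - 1)"
    have \<rho>: "\<rho> > 0" using D by (simp add: \<rho>_def)
    define q where "q x = h (x / \<rho>)" for x
    have cont_q: "continuous_on S q" for S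
      unfolding q_def using \<rho> by (intro continuous_on_compose2[OF cont_h[of UNIV]] continuous_intros) auto
    have q_lower: "(1 - \<epsilon>) * \<rho> * q x \<le> - x * q x" for x
      using mult_left_mono[OF h(3)[of "x / \<rho>"], of \<rho>] \<rho> by (simp add: q_def mult_ac)
    \<comment> \<open>The first bound keeps the integral of \<open>p\<close> above I / 2. The second
      makes the approximation error in the objective, at most (\<rho> + D) \<delta>, no larger than
      \<epsilon> \<rho> times that integral.\<close>
    define \<delta> where "\<delta> = min (I / 2) (\<epsilon> * \<rho> * (I / 2) / (\<rho> + D))"
    have \<delta>: "\<delta> > 0" "\<delta> \<le> I / 2" "(\<rho> + D) * \<delta> \<le> \<epsilon> * \<rho> * (I / 2)"
    proof -
      show "\<delta> > 0" using I eps \<rho> D by (simp add: \<delta>_def)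
      show "\<delta> \<le> I / 2" unfolding \<delta>_def by (rule min.cobounded1)
      have "\<delta> \<le> \<epsilon> * \<rho> * (I / 2) / (\<rho> + D)" by (simp add: \<delta>_def)
      then show "(\<rho> + D) * \<delta> \<le> \<epsilon> * \<rho> * (I / 2)"
        using \<rho> D by (subst mult.commute, subst pos_le_divide_eq[symmetric]) auto
    qed
    obtain p where p: "p \<in> bernstein_cone D" "1 - p \<in> bernstein_cone D"
      and approx: "\<And>x. \<bar>x\<bar> \<le> D \<Longrightarrow> \<bar>q x - poly p x\<bar> < \<delta>"
      using bernstein_cone_approx[of D \<delta> q] D \<delta>(1) cont_q h unfolding q_def by auto
    have cont_p: "continuous_on S (poly r)" for S and r :: "real poly"
      by (intro continuous_intros)
    have km_const: "km D (poly [:c:]) = c" for c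
      using km_poly_smult[of D c 1] km_1[OF D] by simp
    have "I \<le> km D q"
      unfolding I_def km_def
    proof (intro integral_le km_integrable D cont_q integrable_continuous_real cont_I)
      fix \<theta>
      have "q (2 * sqrt (D - 1) * cos \<theta>) = h (cos \<theta>)"
        using \<rho> by (simp add: q_def \<rho>_def)
      then show "h (cos \<theta>) * ((sin \<theta>)\<^sup>2 / 4) \<le> q (2 * sqrt (D - 1) * cos \<theta>) * km_weight D \<theta>"
        using mult_left_mono[OF km_weight_bounds(1)[OF D, of \<theta>] h(1)[of "cos \<theta>"]] by (simp only:)
    qed
    also have "km D q \<le> km D (poly (p + [:\<delta>:]))"
      using approx by (intro km_mono D cont_q cont_p) (force simp: abs_less_iff)
    also have "\<dots> = km D (poly p) + \<delta>"
      by (simp only: km_poly_add[OF D] km_const)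
    finally have m: "I / 2 \<le> km D (poly p)"
      using \<delta> by linarith
    have "km D (poly (smult ((1 - \<epsilon>) * \<rho>) p - [:(\<rho> + D) * \<delta>:])) \<le> km D (poly (smult (-1) ([:0, 1:] * p)))"
    proof (intro km_mono D cont_p)
      fix x :: real assume x: "\<bar>x\<bar> \<le> D"
      define e where "e = poly p x - q x"
      have e: "\<bar>e\<bar> \<le> \<delta>" using approx[OF x] by (simp add: e_def abs_minus_commute)
      have "(x + (1 - \<epsilon>) * \<rho>) * e \<le> \<bar>x + (1 - \<epsilon>) * \<rho>\<bar> * \<bar>e\<bar>"
        by (metis abs_ge_self abs_mult)
      also have "\<dots> \<le> (\<rho> + D) * \<delta>"
      proof (intro mult_mono e)
        have "0 \<le> \<epsilon> * \<rho>" "\<epsilon> * \<rho> \<le> \<rho>" using eps \<rho> by auto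
        then show "\<bar>x + (1 - \<epsilon>) * \<rho>\<bar> \<le> \<rho> + D"
          using x by (auto simp: algebra_simps abs_le_iff)
      qed (use \<rho> D in auto)
      finally have "(x + (1 - \<epsilon>) * \<rho>) * e \<le> (\<rho> + D) * \<delta>" .
      moreover have "(x + (1 - \<epsilon>) * \<rho>) * q x \<le> 0"
        using q_lower[of x] by (simp add: distrib_right)
      moreover have "(x + (1 - \<epsilon>) * \<rho>) * poly p x = (x + (1 - \<epsilon>) * \<rho>) * q x + (x + (1 - \<epsilon>) * \<rho>) * e"
        by (simp add: e_def algebra_simps)
      ultimately have "(x + (1 - \<epsilon>) * \<rho>) * poly p x \<le> (\<rho> + D) * \<delta>" by linarith
      then show "poly (smult ((1 - \<epsilon>) * \<rho>) p - [:(\<rho> + D) * \<delta>:]) x \<le> poly (smult (- 1) ([:0, 1:] * p)) x"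
        by (simp add: algebra_simps)
    qed
    then have "(1 - \<epsilon>) * \<rho> * km D (poly p) - (\<rho> + D) * \<delta> \<le> - km D (poly ([:0, 1:] * p))"
      by (simp only: km_poly_diff[OF D] km_poly_smult km_const)
    moreover have "\<epsilon> * \<rho> * (I / 2) \<le> \<epsilon> * \<rho> * km D (poly p)"
      using m eps \<rho> by (intro mult_left_mono) auto
    ultimately have "(1 - 2 * \<epsilon>) * \<rho> * km D (poly p) \<le> - km D (poly ([:0, 1:] * p))"
      using \<delta>(3) by (simp only: left_diff_distrib mult_1)
    then show ?thesis
      using p m unfolding \<rho>_def by blast
  qed
  then show ?thesis
    using I by (intro exI[of _ "I / 2"]) auto
qed

section \<open>Entries of p(A) in the rows of good vertices\<close>

context regular_graph
begin

text \<open>Both sides are linear in \<open>p\<close>, take the value 1 at the constant 1 and vanish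
  at the nonbacktracking polynomials of index 1 to \<open>M\<close>, by
  \<open>nb_walks_closed\<close> and \<open>km_nb_poly\<close>.\<close>

lemma pmat_good_diagonal:
  assumes d: "d \<ge> 3" and u: "u \<notin> bad_vertices n G M" "u < n" and p: "degree p \<le> M"
  shows "pmat n (adj_matrix G) p u u = km d (poly p)"
proof -
  have d': "real d \<ge> 3" using d by simp
  obtain c where c: "p = (\<Sum>k\<le>M. smult (c k) (nb_poly d k))"
    using nb_poly_expansion[OF p] .
  have "pmat n (adj_matrix G) (nb_poly d k) u u = km d (poly (nb_poly d k))" if "k \<le> M" for k
    using nb_walks_closed[OF u, of k] that u(2)
    by (cases "k = 0") (auto simp: pmat_nb_poly km_nb_poly[OF d'] nb_walks_def km_1[OF d'])
  then show ?thesis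
    unfolding c by (simp add: pmat_sum km_poly_sum[OF d'] km_poly_smult)
qed

text \<open>Around a good vertex the nonbacktracking walks of different lengths have disjoint sets of
  endpoints, and each endpoint is reached once. So \<open>p(A)\<^bsub>uv\<^esub>\<close> is a single coefficient of \<open>p\<close> in the
  orthogonal system of nonbacktracking polynomials, and Bessel's inequality bounds it.\<close>

lemma pmat_good_entry_bound:
  assumes d: "d \<ge> 3" and u: "u \<notin> bad_vertices n G M" "u < n" and v: "v < n" "v \<noteq> u"
    and p: "2 * degree p \<le> M" and p01: "\<And>x. \<bar>x\<bar> \<le> real d \<Longrightarrow> 0 \<le> poly p x \<and> poly p x \<le> 1"
  shows "\<bar>pmat n (adj_matrix G) p u v\<bar> \<le> 1 / sqrt d"
proof -
  have d': "real d \<ge> 3" using d by simp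
  let ?Q = "nb_poly (real d)" and ?L = "degree p"
  obtain c where c: "p = (\<Sum>k\<le>?L. smult (c k) (?Q k))"
    using nb_poly_expansion[of p ?L] by blast
  \<comment> \<open>Inner products of walk counts in row \<open>u\<close> are diagonal entries of a
    product of degree up to 2 \<open>?L\<close>, which is why \<open>M\<close> has to be at least
    twice the degree of \<open>p\<close>.\<close>
  have inner: "(\<Sum>w<n. real (nbw j u w) * real (nbw k u w)) = km d (poly (?Q j * ?Q k))"
    if "j \<le> ?L" "k \<le> ?L" for j k
  proof -
    have "(\<Sum>w<n. real (nbw j u w) * real (nbw k u w)) =
        (\<Sum>w<n. pmat n (adj_matrix G) (?Q j) u w * pmat n (adj_matrix G) (?Q k) w u)"
      using u(2) by (intro sum.cong refl)
        (simp add: pmat_nb_poly pmat_sym[OF adj_matrix_sym, of _ n u])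
    also have "\<dots> = pmat n (adj_matrix G) (?Q j * ?Q k) u u"
      using u(2) by (simp add: pmat_mult)
    also have "\<dots> = km d (poly (?Q j * ?Q k))"
    proof (rule pmat_good_diagonal[OF d u])
      have "degree (?Q j * ?Q k) \<le> degree (?Q j) + degree (?Q k)" by (rule degree_mult_le)
      also have "\<dots> \<le> M"
        using degree_nb_poly[of d j] degree_nb_poly[of d k] that p by linarith
      finally show "degree (?Q j * ?Q k) \<le> M" .
    qed
    finally show ?thesis .
  qed
  have disjoint: "nbw j u v = 0 \<or> nbw k u v = 0" if "j \<le> ?L" "k \<le> ?L" "j \<noteq> k" for j k
  proof -
    have "(\<Sum>w<n. real (nbw j u w) * real (nbw k u w)) = 0"
      using inner[OF that(1,2)] km_nb_poly_orthogonal[OF d' that(3)] by simp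
    then show ?thesis
      using v(1) by (subst (asm) sum_nonneg_eq_0_iff) auto
  qed
  \<comment> \<open>The sum of the counts and the sum of their squares are both d (d - 1)^k; for
    natural numbers this forces every count to be 0 or 1.\<close>
  have le_1: "nbw (Suc k) u v \<le> 1" if "Suc k \<le> ?L" for k
  proof -
    have "(\<Sum>w<n. real (nbw (Suc k) u w)) = real (\<Sum>w<n. nbw (Suc k) u w)" by simp
    also have "\<dots> = d * (real d - 1) ^ k"
      using d unfolding sum_nb_walks_Suc[OF u(2)] by (simp add: of_nat_diff)
    also have "\<dots> = (\<Sum>w<n. real (nbw (Suc k) u w) * real (nbw (Suc k) u w))"
      using inner[OF that that] km_nb_poly_norm[OF d', of k] by simp
    finally have "(\<Sum>w<n. real (nbw (Suc k) u w) * (real (nbw (Suc k) u w) - 1)) = 0"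
      by (simp add: algebra_simps sum_subtractf)
    moreover have "0 \<le> real m * (real m - 1)" for m :: nat
      by (cases m) auto
    ultimately have "real (nbw (Suc k) u v) * (real (nbw (Suc k) u v) - 1) = 0"
      using v(1) by (subst (asm) sum_nonneg_eq_0_iff) auto
    then show ?thesis by auto
  qed
  have coeff_bound: "\<bar>c (Suc k)\<bar> \<le> 1 / sqrt d" if k: "Suc k \<le> ?L" for k
  proof -
    let ?q = "?Q (Suc k)" and ?N = "d * (real d - 1) ^ k"
    have N: "km d (poly (?q * ?q)) = ?N"
      using km_nb_poly_norm[OF d', of k] by simp
    have "km d (poly (p * ?q)) = (\<Sum>j\<le>?L. c j * km d (poly (?Q j * ?q)))"
    proof -
      have "p * ?q = (\<Sum>j\<le>?L. smult (c j) (?Q j * ?q))"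
        by (subst c) (simp add: sum_distrib_right)
      then show ?thesis
        by (simp only: km_poly_sum[OF d'] km_poly_smult)
    qed
    also have "\<dots> = (\<Sum>j\<le>?L. if j = Suc k then c j * ?N else 0)"
      by (intro sum.cong refl) (use N km_nb_poly_orthogonal[OF d'] in auto)
    also have "\<dots> = c (Suc k) * ?N"
      using k by simp
    finally have pq: "km d (poly (p * ?q)) = c (Suc k) * ?N" .
    \<comment> \<open>The residual of \<open>p\<close> after projection onto one basis polynomial
      has nonnegative norm, and \<open>p\<close> has norm at most 1 because 0 \<le> p \<le> 1 and
      \<open>km\<close> has total mass 1. The norm of the basis polynomial is at least d, whence 1 /
      sqrt d.\<close>
    let ?r = "p - smult (c (Suc k)) ?q"
    have "0 = km d (poly 0)" by simp
    also have "\<dots> \<le> km d (poly (?r * ?r))"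
      by (intro km_mono d' continuous_intros) simp
    also have "?r * ?r = p * p - smult (2 * c (Suc k)) (p * ?q) + smult ((c (Suc k))\<^sup>2) (?q * ?q)"
      by (simp add: algebra_simps power2_eq_square smult_add_left[symmetric] del: nb_poly.simps)
    also have "km d (poly \<dots>) = km d (poly (p * p)) - (c (Suc k))\<^sup>2 * ?N"
      by (simp only: km_poly_add[OF d'] km_poly_diff[OF d'] km_poly_smult pq N) (simp add: power2_eq_square)
    also have "km d (poly (p * p)) \<le> km d (poly 1)"
      using p01 by (intro km_mono d' continuous_intros) (simp add: mult_le_one)
    also have "\<dots> = 1" by (rule km_1[OF d'])
    finally have 1: "(c (Suc k))\<^sup>2 * ?N \<le> 1" by simp
    have "(c (Suc k))\<^sup>2 * real d \<le> (c (Suc k))\<^sup>2 * ?N"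
      using d' by (intro mult_left_mono) (auto simp: one_le_power)
    also note 1
    finally have "(c (Suc k))\<^sup>2 \<le> (1 / sqrt d)\<^sup>2"
      using d' by (simp add: power_divide field_simps)
    then show ?thesis
      by (simp add: abs_le_square_iff[symmetric])
  qed
  have entry: "pmat n (adj_matrix G) p u v = (\<Sum>k\<le>?L. c k * nbw k u v)"
    using u(2) v(1) by (subst c) (simp add: pmat_sum pmat_nb_poly)
  show ?thesis
  proof (cases "\<forall>k\<le>?L. nbw k u v = 0")
    case True
    then show ?thesis by (simp add: entry)
  next
    case False
    then obtain k where k: "k \<le> ?L" "nbw k u v \<noteq> 0" by blast
    then obtain j where j: "k = Suc j"
      using v(2) by (cases k) (auto simp: nb_walks_def)
    have "pmat n (adj_matrix G) p u v = (\<Sum>i\<le>?L. if i = k then c i * nbw i u v else 0)"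
      unfolding entry using disjoint[of _ k] k by (intro sum.cong refl) auto
    also have "\<dots> = c k"
      using k le_1[of j] by (simp add: j)
    finally show ?thesis
      using coeff_bound[of j] k j by simp
  qed
qed

end

section \<open>Vertices near short cycles in a random regular graph\<close>

lemma finite_regular_graphs: "finite (regular_graphs n d)"
  by (rule finite_subset[of _ "Pow (Pow {..<n})"]) (auto simp: regular_graphs_def)

text \<open>The witness is a circulant graph: \<open>D u v\<close> is v - u modulo n, and the
  connection set \<open>T\<close> is closed under negation. For odd \<open>d\<close> the number n is
  even, and the involution n / 2 supplies the odd element. Nonemptiness makes
  \<open>pmf_of_set\<close> the uniform distribution.\<close>

lemma regular_graphs_nonempty:
  assumes "d < n" "even (d * n)"
  shows "regular_graphs n d \<noteq> {}"
proof -
  define h where "h = d div 2"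
  define T where "T = {1..h} \<union> {n - h..<n} \<union> (if odd d then {n div 2} else {})"
  define D where "D u v = (if u \<le> v then v - u else v + n - u)" for u v :: nat
  define G where "G = {{u, v} |u v. u < n \<and> v < n \<and> D u v \<in> T}"
  have n2: "2 * (n div 2) = n" if "odd d"
    using assms that by simp
  have d2: "odd d \<Longrightarrow> Suc (2 * h) = d" "even d \<Longrightarrow> 2 * h = d"
    by (simp_all add: h_def)
  have h: "2 * h < n" "odd d \<Longrightarrow> h < n div 2"
  proof -
    show "2 * h < n" using assms(1) by (simp add: h_def)
    show "h < n div 2" if "odd d"
      using n2[OF that] d2(1)[OF that] assms(1) by linarith
  qed
  have T_range: "0 < t \<and> t < n" if "t \<in> T" for t
    using that h(1) n2 by (auto simp: T_def split: if_splits)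
  have T_sym: "n - t \<in> T" if "t \<in> T" for t
  proof -
    consider "1 \<le> t" "t \<le> h" | "n - h \<le> t" "t < n" | "odd d" "t = n div 2"
      using \<open>t \<in> T\<close> by (auto simp: T_def split: if_splits)
    then show ?thesis
    proof cases
      case 3
      then have "n - t = n div 2" using n2 by simp
      then show ?thesis using 3 by (simp add: T_def)
    qed (use h(1) in \<open>auto simp: T_def\<close>)
  qed
  have card_T: "card T = d"
  proof -
    have "card ({1..h} \<union> {n - h..<n}) = 2 * h"
      using h by (subst card_Un_disjoint) auto
    moreover have "n div 2 \<notin> {1..h} \<union> {n - h..<n}" if "odd d"
      using h(2)[OF that] n2[OF that] by auto
    ultimately show ?thesis
      using d2 by (cases "odd d") (simp_all add: T_def)
  qed
  have D_sym: "D v u \<in> T" if "D u v \<in> T" "u < n" "v < n" for u v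
  proof -
    have "D v u = n - D u v"
      using T_range[OF that(1)] that(2,3) by (auto simp: D_def split: if_splits)
    then show ?thesis using T_sym[OF that(1)] by simp
  qed
  have "card {e \<in> G. v \<in> e} = d" if v: "v < n" for v
  proof -
    have 1: "bij_betw (\<lambda>w. {v, w}) {w. w < n \<and> D v w \<in> T} {e \<in> G. v \<in> e}"
    proof (rule bij_betwI')
      fix w w' show "({v, w} = {v, w'}) = (w = w')" by (auto simp: doubleton_eq_iff)
    next
      fix w assume "w \<in> {w. w < n \<and> D v w \<in> T}"
      then show "{v, w} \<in> {e \<in> G. v \<in> e}" using v by (auto simp: G_def)
    next
      fix e assume "e \<in> {e \<in> G. v \<in> e}"
      then obtain u w where e: "e = {u, w}" "u < n" "w < n" "D u w \<in> T" "v = u \<or> v = w"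
        by (auto simp: G_def)
      then show "\<exists>w\<in>{w. w < n \<and> D v w \<in> T}. e = {v, w}"
        using D_sym[of u w] by (cases "v = u") auto
    qed
    have 2: "bij_betw (\<lambda>t. if v + t < n then v + t else v + t - n) T {w. w < n \<and> D v w \<in> T}"
    proof (rule bij_betwI[where g = "D v"])
      show "(\<lambda>t. if v + t < n then v + t else v + t - n) \<in> T \<rightarrow> {w. w < n \<and> D v w \<in> T}"
      proof
        fix t assume t: "t \<in> T"
        have "D v (if v + t < n then v + t else v + t - n) = t"
          using T_range[OF t] v by (auto simp: D_def)
        then show "(if v + t < n then v + t else v + t - n) \<in> {w. w < n \<and> D v w \<in> T}"
          using T_range[OF t] v t by auto
      qed
    next
      fix t assume t: "t \<in> T"
      show "D v (if v + t < n then v + t else v + t - n) = t"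
        using T_range[OF t] v by (auto simp: D_def)
    next
      fix w assume "w \<in> {w. w < n \<and> D v w \<in> T}"
      then show "(if v + D v w < n then v + D v w else v + D v w - n) = w"
        using v by (auto simp: D_def)
    qed auto
    show ?thesis
      using bij_betw_same_card[OF 1] bij_betw_same_card[OF 2] card_T by linarith
  qed
  moreover have "G \<subseteq> {e. e \<subseteq> {..<n} \<and> card e = 2}"
  proof
    fix e assume "e \<in> G"
    then obtain u v where e: "e = {u, v}" "u < n" "v < n" "D u v \<in> T"
      by (auto simp: G_def)
    then have "u \<noteq> v" using T_range[of "D u v"] by (auto simp: D_def)
    with e show "e \<in> {e. e \<subseteq> {..<n} \<and> card e = 2}" by auto
  qed
  ultimately have "G \<in> regular_graphs n d"
    by (simp add: regular_graphs_def)
  then show ?thesis by blast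
qed

section \<open>Edge switchings\<close>

definition walks :: "nat \<Rightarrow> nat set set \<Rightarrow> nat \<Rightarrow> nat list set" where
  "walks n G m = {w. length w = Suc m \<and> set w \<subseteq> {..<n} \<and> successively (\<lambda>x y. {x, y} \<in> G) w}"

definition switch :: "'v set set \<Rightarrow> 'v \<Rightarrow> 'v \<Rightarrow> 'v \<Rightarrow> 'v \<Rightarrow> 'v set set" where
  "switch G a b x y = (G - {{a, b}, {x, y}}) \<union> {{a, x}, {b, y}}"

text \<open>The pair is ordered. Keeping \<open>x\<close> off the path ensures that removing {x, y}
  leaves the path intact; the other conditions make the two inserted edges genuine and new.\<close>

definition switchings :: "nat set set \<Rightarrow> nat list \<Rightarrow> nat \<Rightarrow> nat \<Rightarrow> (nat \<times> nat) set" where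
  "switchings G w m i = {(x, y). {x, y} \<in> G \<and> x \<notin> set w \<and> y \<noteq> w ! m \<and> y \<noteq> w ! i \<and>
     {w ! m, x} \<notin> G \<and> {w ! i, y} \<notin> G}"

lemma finite_walks: "finite (walks n G m)"
proof (rule finite_subset)
  show "walks n G m \<subseteq> {w. set w \<subseteq> {..<n} \<and> length w = Suc m}"
    by (auto simp: walks_def)
qed (simp add: finite_lists_length_eq)

lemma finite_lollipops: "finite (lollipops n G m)"
proof (rule finite_subset)
  show "lollipops n G m \<subseteq> walks n G m \<times> {..<m}"
    by (auto simp: walks_def lollipops_def)
qed (simp add: finite_walks)

context regular_graph
begin

lemma finite_G: "finite G"
proof -
  have "G \<subseteq> Pow {..<n}" using G by (auto simp: regular_graphs_def)
  then show ?thesis by (rule finite_subset) simp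
qed

lemma card_walks: "card (walks n G m) \<le> n * d ^ m"
proof (induction m)
  case 0
  have "walks n G 0 \<subseteq> (\<lambda>v. [v]) ` {..<n}"
    by (auto simp: walks_def length_Suc_conv)
  then have "card (walks n G 0) \<le> card ((\<lambda>v. [v]) ` {..<n})"
    by (intro card_mono) auto
  also have "\<dots> \<le> n"
    using card_image_le[of "{..<n}" "\<lambda>v. [v]"] by simp
  finally show ?case by simp
next
  case (Suc m)
  let ?S = "SIGMA w:walks n G m. nbrs G (last w)"
  have "walks n G (Suc m) \<subseteq> (\<lambda>(w, x). w @ [x]) ` ?S"
  proof
    fix w assume w: "w \<in> walks n G (Suc m)"
    then have "w \<noteq> []" by (auto simp: walks_def)
    then obtain w' x where [simp]: "w = w' @ [x]" by (metis rev_exhaust)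
    have "w' \<noteq> []" using w by (auto simp: walks_def)
    then have "(w', x) \<in> ?S"
      using w by (auto simp: walks_def successively_append_iff)
    then show "w \<in> (\<lambda>(w, x). w @ [x]) ` ?S"
      by (rule image_eqI[rotated]) simp
  qed
  then have "card (walks n G (Suc m)) \<le> card ((\<lambda>(w, x). w @ [x]) ` ?S)"
    by (intro card_mono finite_imageI finite_SigmaI finite_walks) auto
  also have "\<dots> \<le> card ?S"
    by (intro card_image_le finite_SigmaI finite_walks) auto
  also have "\<dots> = (\<Sum>w\<in>walks n G m. card (nbrs G (last w)))"
    by (simp add: finite_walks)
  also have "\<dots> = (\<Sum>w\<in>walks n G m. d)"
  proof (intro sum.cong refl card_nbrs)
    fix w assume "w \<in> walks n G m"
    then have "w \<noteq> []" "set w \<subseteq> {..<n}" by (auto simp: walks_def)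
    then show "last w < n" using last_in_set[of w] lessThan_iff by blast
  qed
  also have "\<dots> \<le> n * d ^ m * d"
    using mult_right_mono[OF Suc.IH, of d] by simp
  finally show ?case by (simp add: mult_ac)
qed

text \<open>The removed and the inserted edges cover a, b, x, y with the same multiplicities, so an
  indicator summed over the edges is unchanged at every vertex.\<close>

lemma switch_regular:
  assumes e: "{a, b} \<in> G" "{x, y} \<in> G" and new: "{a, x} \<notin> G" "{b, y} \<notin> G"
    and ne: "x \<noteq> a" "x \<noteq> b" "y \<noteq> a" "y \<noteq> b"
  shows "switch G a b x y \<in> regular_graphs n d"
proof -
  note ab = edge_props[OF e(1)] and xy = edge_props[OF e(2)]
  have "{a, b} \<noteq> {x, y}" "{a, x} \<noteq> {b, y}"
    using ab(3) ne by (auto simp only: doubleton_eq_iff)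
  moreover have "switch G a b x y = insert {a, x} (insert {b, y} (G - {{a, b}} - {{x, y}}))"
    unfolding switch_def by blast
  ultimately have sum_switch: "(\<Sum>e\<in>switch G a b x y. g e) + (g {a, b} + g {x, y}) = (\<Sum>e\<in>G. g e) + (g {a, x} + g {b, y})"
    for g :: "nat set \<Rightarrow> nat"
    using e new finite_G by (simp add: sum.remove[of G "{a, b}"] sum.remove[of "G - {{a, b}}" "{x, y}"])
  have card_eq: "card {e \<in> H. v \<in> e} = (\<Sum>e\<in>H. of_bool (v \<in> e))" if "finite H" for H :: "nat set set" and v
    using that by (simp add: of_bool_def sum.If_cases Int_def)
  have fin: "finite (switch G a b x y)"
    using finite_G by (simp add: switch_def)
  have "card {e \<in> switch G a b x y. v \<in> e} = d" if v: "v < n" for v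
  proof -
    have "of_bool (v \<in> {p, q}) = (of_bool (v = p) + of_bool (v = q) :: nat)" if "p \<noteq> q" for p q
      using that by auto
    from this[of a b] this[of x y] this[of a x] this[of b y] sum_switch[of "\<lambda>e. of_bool (v \<in> e)"]
    have "(\<Sum>e\<in>switch G a b x y. of_bool (v \<in> e)) = (\<Sum>e\<in>G. of_bool (v \<in> e) :: nat)"
      using ab(3) xy(3) ne by linarith
    also have "\<dots> = d"
      using G v card_eq[OF finite_G, of v] by (simp add: regular_graphs_def)
    finally show ?thesis
      using card_eq[OF fin, of v] by simp
  qed
  moreover have "switch G a b x y \<subseteq> {e. e \<subseteq> {..<n} \<and> card e = 2}"
  proof -
    have "G \<subseteq> {e. e \<subseteq> {..<n} \<and> card e = 2}"
      using G by (simp add: regular_graphs_def)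
    moreover have "card {a, x} = 2" "card {b, y} = 2" using ne by simp_all
    ultimately show ?thesis
      using ab xy unfolding switch_def by (intro Un_least) auto
  qed
  ultimately show ?thesis by (simp add: regular_graphs_def)
qed

lemma finite_switchings: "finite (switchings G w m i)"
  by (rule finite_subset[of _ "{..<n} \<times> {..<n}"]) (auto simp: switchings_def dest: edge_props)

text \<open>Of the n d oriented edges, those excluded have \<open>x\<close> on the path (at most (m
  + 1) d), \<open>y\<close> equal to one of the two ends of the closing edge (2 d), \<open>x\<close>
  adjacent to \<open>w ! m\<close>, or \<open>y\<close> adjacent to \<open>w ! i\<close> (d^2
  each).\<close>

lemma card_switchings:
  assumes w: "(w, i) \<in> lollipops n G m"
  shows "n * d \<le> card (switchings G w m i) + d * (m + 3 + 2 * d)"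
proof -
  let ?a = "w ! m" and ?b = "w ! i"
  have len: "length w = Suc m" "i < Suc m" "set w \<subseteq> {..<n}"
    using w by (auto simp: lollipops_def)
  have ab: "?a < n" "?b < n"
    using subsetD[OF len(3) nth_mem[of m w]] subsetD[OF len(3) nth_mem[of i w]] len(1,2) by simp_all
  have sig: "card (SIGMA x:X. nbrs G x) = card X * d" if "X \<subseteq> {..<n}" for X
  proof -
    have "finite X" using that finite_subset by blast
    then have "card (SIGMA x:X. nbrs G x) = (\<Sum>x\<in>X. card (nbrs G x))" by simp
    also have "\<dots> = (\<Sum>x\<in>X. d)" using that by (intro sum.cong refl card_nbrs) auto
    finally show ?thesis by simp
  qed
  have fin: "finite (SIGMA x:X. nbrs G x)" if "X \<subseteq> {..<n}" for X
    using that by (intro finite_SigmaI finite_subset[OF that]) auto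
  let ?B1 = "SIGMA x:set w. nbrs G x" and ?B2 = "prod.swap ` (SIGMA y:{?a, ?b}. nbrs G y)"
    and ?B3 = "SIGMA x:nbrs G ?a. nbrs G x" and ?B4 = "prod.swap ` (SIGMA y:nbrs G ?b. nbrs G y)"
  have "(SIGMA x:{..<n}. nbrs G x) \<subseteq> switchings G w m i \<union> (?B1 \<union> ?B2 \<union> ?B3 \<union> ?B4)"
    by (auto simp: switchings_def image_iff insert_commute)
  then have "card (SIGMA x:{..<n}. nbrs G x) \<le> card (switchings G w m i \<union> (?B1 \<union> ?B2 \<union> ?B3 \<union> ?B4))"
    using len ab nbrs_subset by (intro card_mono finite_UnI finite_imageI finite_switchings fin) auto
  also have "\<dots> \<le> card (switchings G w m i) + (card ?B1 + card ?B2 + card ?B3 + card ?B4)"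
    by (intro order_trans[OF card_Un_le] add_mono order_refl)
  also have "card (SIGMA x:{..<n}. nbrs G x) = n * d"
    using sig[of "{..<n}"] by simp
  finally have 1: "n * d \<le> card (switchings G w m i) + (card ?B1 + card ?B2 + card ?B3 + card ?B4)" .
  have "card ?B1 \<le> Suc m * d"
    using sig[OF len(3)] card_length[of w] len(1) by (simp add: mult_right_mono del: mult_Suc)
  moreover have "card ?B2 \<le> 2 * d"
  proof -
    have "card ?B2 \<le> card {?a, ?b} * d"
      using card_image_le[OF fin[of "{?a, ?b}"], of prod.swap] sig[of "{?a, ?b}"] ab by auto
    also have "\<dots> \<le> 2 * d" by (intro mult_right_mono) (auto simp: card_insert_if)
    finally show ?thesis .
  qed
  moreover have "card ?B3 \<le> d * d"
    using sig[OF nbrs_subset[of ?a]] card_nbrs[OF ab(1)] by simp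
  moreover have "card ?B4 \<le> d * d"
    using card_image_le[OF fin[OF nbrs_subset[of ?b]], of prod.swap] sig[OF nbrs_subset[of ?b]]
      card_nbrs[OF ab(2)] by simp
  ultimately have "card ?B1 + card ?B2 + card ?B3 + card ?B4 \<le> d * (m + 3 + 2 * d)"
    by (simp add: algebra_simps)
  with 1 show ?thesis by linarith
qed

text \<open>The last claim is the inverse switching: the new graph together with \<open>w\<close>,
  \<open>i\<close>, \<open>x\<close>, \<open>y\<close> determines the old one, which gives
  injectivity in the count below.\<close>

lemma lollipop_switch:
  assumes w: "(w, i) \<in> lollipops n G m" and xy: "(x, y) \<in> switchings G w m i"
  defines "G' \<equiv> switch G (w ! m) (w ! i) x y"
  shows "G' \<in> regular_graphs n d" "w \<in> walks n G' m" "i < Suc m"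
    "{w ! m, x} \<in> G'" "{w ! i, y} \<in> G'" "switch G' (w ! m) x (w ! i) y = G"
proof -
  let ?a = "w ! m" and ?b = "w ! i"
  have len: "length w = Suc m" "Suc (Suc i) \<le> m" "distinct w" "{?a, ?b} \<in> G"
    and succ: "successively (\<lambda>x y. {x, y} \<in> G) w"
    using w by (auto simp: lollipops_def)
  have in_w: "?a \<in> set w" "?b \<in> set w"
    using len by auto
  have x: "{x, y} \<in> G" "x \<notin> set w" "y \<noteq> ?a" "y \<noteq> ?b" "{?a, x} \<notin> G" "{?b, y} \<notin> G"
    using xy by (auto simp: switchings_def)
  show "G' \<in> regular_graphs n d"
    unfolding G'_def using len x in_w by (intro switch_regular) auto
  show "i < Suc m" using len by simp
  show "{w ! m, x} \<in> G'" "{w ! i, y} \<in> G'"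
    by (auto simp: G'_def switch_def)
  show "switch G' ?a x ?b y = G"
    using x len unfolding G'_def switch_def by blast
  have "{w ! j, w ! Suc j} \<in> G'" if j: "Suc j < length w" for j
  proof -
    have "{w ! j, w ! Suc j} \<in> G"
      using succ j by (simp add: successively_conv_nth)
    moreover have "{w ! j, w ! Suc j} \<noteq> {x, y}"
      using x(2) j nth_mem[of j w] nth_mem[of "Suc j" w] by (auto simp: doubleton_eq_iff)
    \<comment> \<open>The path is distinct and i + 2 \<le> m, so the closing edge joins positions
      that are not consecutive.\<close>
    moreover have "{w ! j, w ! Suc j} \<noteq> {?a, ?b}"
      using len j by (auto simp: doubleton_eq_iff nth_eq_iff_index_eq)
    ultimately show ?thesis by (simp add: G'_def switch_def)
  qed
  then have "successively (\<lambda>x y. {x, y} \<in> G') w"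
    by (simp add: successively_conv_nth)
  then show "w \<in> walks n G' m"
    using w by (auto simp: walks_def lollipops_def)
qed

end

text \<open>Removing the closing edge \<open>{a, b}\<close> of a lollipop together with a further edge \<open>{x, y}\<close>, and
  inserting \<open>{a, x}\<close> and \<open>{b, y}\<close>, gives an injection from about \<open>n d\<close> switchings for every lollipop
  into walks of length \<open>m\<close> with two decorations, of which there are only \<open>O(n)\<close> in each graph.\<close>

lemma sum_card_lollipops:
  fixes n d m :: nat
  assumes d: "d > 0" and n: "2 * (m + 3 + 2 * d) \<le> n"
  shows "(\<Sum>G\<in>regular_graphs n d. card (lollipops n G m)) \<le>
    card (regular_graphs n d) * (2 * d ^ Suc m * Suc m)"
proof -
  let ?R = "regular_graphs n d" and ?L = "\<lambda>G. lollipops n G m"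
  let ?s = "\<Sum>G\<in>?R. card (?L G)"
  define S where "S = (SIGMA G:?R. SIGMA l:?L G. switchings G (fst l) m (snd l))"
  \<comment> \<open>After switching, \<open>x\<close> is a neighbour of \<open>w ! m\<close> and
    \<open>y\<close> one of \<open>w ! i\<close>, so the two decorations have only d^2
    choices.\<close>
  define T where "T = (SIGMA G:?R. SIGMA w:walks n G m. SIGMA i:{..<Suc m}. nbrs G (w ! m) \<times> nbrs G (w ! i))"
  define F where "F = (\<lambda>(G, (w, i), (x, y)). (switch G (w ! m) (w ! i) x y, w, i, x, y :: nat))"
  have reg: "regular_graph n d G" if "G \<in> ?R" for G
    using that by unfold_locales
  have fin_T: "finite T"
    unfolding T_def
    by (intro finite_SigmaI finite_cartesian_product finite_regular_graphs finite_walks)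
      (auto intro: regular_graph.finite_nbrs[OF reg])
  have FS: "F z \<in> T \<and> (\<forall>z'\<in>S. F z = F z' \<longrightarrow> z = z')" if "z \<in> S" for z
  proof -
    obtain G w i x y where z: "z = (G, (w, i), (x, y))" by (cases z) auto
    then have G: "G \<in> ?R" "(w, i) \<in> ?L G" "(x, y) \<in> switchings G w m i"
      using that by (auto simp: S_def)
    note sw = regular_graph.lollipop_switch[OF reg[OF G(1)] G(2,3)]
    have "F z \<in> T"
      using sw(1-5) by (auto simp: F_def T_def z)
    moreover have "z = z'" if z': "z' \<in> S" "F z = F z'" for z'
    proof -
      obtain G' w' i' x' y' where zz: "z' = (G', (w', i'), (x', y'))" by (cases z') auto
      then have G': "G' \<in> ?R" "(w', i') \<in> ?L G'" "(x', y') \<in> switchings G' w' m i'"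
        using z'(1) by (auto simp: S_def)
      have eq: "w' = w" "i' = i" "x' = x" "y' = y"
        "switch G (w ! m) (w ! i) x y = switch G' (w ! m) (w ! i) x y"
        using z'(2) by (auto simp: F_def z zz)
      from regular_graph.lollipop_switch(6)[OF reg[OF G'(1)] G'(2,3)] sw(6) eq
      show ?thesis by (simp add: z zz)
    qed
    ultimately show ?thesis by blast
  qed
  have "card S \<le> card T"
    by (rule card_inj_on_le[of F]) (use FS fin_T in \<open>auto simp: inj_on_def\<close>)
  also have "card T \<le> card ?R * (n * d ^ m * (Suc m * (d * d)))"
  proof -
    have "card (SIGMA w:walks n G m. SIGMA i:{..<Suc m}. nbrs G (w ! m) \<times> nbrs G (w ! i)) \<le>
        n * d ^ m * (Suc m * (d * d))" if G: "G \<in> ?R" for G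
    proof -
      interpret regular_graph n d G by (rule reg[OF G])
      have "card (SIGMA i:{..<Suc m}. nbrs G (w ! m) \<times> nbrs G (w ! i)) = Suc m * (d * d)"
        if w: "w \<in> walks n G m" for w
      proof -
        have len: "length w = Suc m" "set w \<subseteq> {..<n}" using w by (auto simp: walks_def)
        have "w ! i < n" if "i < Suc m" for i
          using subsetD[OF len(2) nth_mem[of i w]] that len(1) by simp
        then have "(\<Sum>i<Suc m. card (nbrs G (w ! m) \<times> nbrs G (w ! i))) = (\<Sum>i<Suc m. d * d)"
          by (intro sum.cong refl) (simp add: card_cartesian_product card_nbrs)
        then show ?thesis by (simp del: sum.lessThan_Suc)
      qed
      then have "card (SIGMA w:walks n G m. SIGMA i:{..<Suc m}. nbrs G (w ! m) \<times> nbrs G (w ! i)) =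
          card (walks n G m) * (Suc m * (d * d))"
        by (subst card_SigmaI) (auto intro: finite_walks)
      also have "\<dots> \<le> n * d ^ m * (Suc m * (d * d))"
        by (intro mult_right_mono card_walks) simp
      finally show ?thesis .
    qed
    then have "(\<Sum>G\<in>?R. card (SIGMA w:walks n G m. SIGMA i:{..<Suc m}. nbrs G (w ! m) \<times> nbrs G (w ! i))) \<le>
        (\<Sum>G\<in>?R. n * d ^ m * (Suc m * (d * d)))"
      by (rule sum_mono)
    moreover have "card T = (\<Sum>G\<in>?R. card (SIGMA w:walks n G m. SIGMA i:{..<Suc m}. nbrs G (w ! m) \<times> nbrs G (w ! i)))"
      unfolding T_def
      by (intro card_SigmaI ballI finite_regular_graphs finite_SigmaI finite_walks finite_cartesian_product
          regular_graph.finite_nbrs[OF reg] finite_lessThan)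
    ultimately show ?thesis by simp
  qed
  finally have upper: "card S \<le> card ?R * (n * d ^ m * (Suc m * (d * d)))" .
  \<comment> \<open>The lower bound on \<open>n\<close> makes at least half of the n d oriented
    edges admissible for every lollipop.\<close>
  have "?s * (n * d) \<le> 2 * card S"
  proof -
    have "card (?L G) * (n * d) \<le> 2 * card (SIGMA l:?L G. switchings G (fst l) m (snd l))"
      if G: "G \<in> ?R" for G
    proof -
      interpret regular_graph n d G by (rule reg[OF G])
      have "n * d \<le> 2 * card (switchings G (fst l) m (snd l))" if "l \<in> ?L G" for l
      proof -
        have "2 * (d * (m + 3 + 2 * d)) \<le> n * d"
          using mult_right_mono[OF n, of d] by (simp add: mult_ac)
        moreover have "n * d \<le> card (switchings G (fst l) m (snd l)) + d * (m + 3 + 2 * d)"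
          using card_switchings[of "fst l" "snd l" m] that by simp
        ultimately show ?thesis by linarith
      qed
      then have "(\<Sum>l\<in>?L G. n * d) \<le> (\<Sum>l\<in>?L G. 2 * card (switchings G (fst l) m (snd l)))"
        by (rule sum_mono)
      also have "\<dots> = 2 * card (SIGMA l:?L G. switchings G (fst l) m (snd l))"
        by (subst card_SigmaI) (auto simp: finite_lollipops finite_switchings sum_distrib_left)
      finally show ?thesis by simp
    qed
    then have "(\<Sum>G\<in>?R. card (?L G) * (n * d)) \<le>
        (\<Sum>G\<in>?R. 2 * card (SIGMA l:?L G. switchings G (fst l) m (snd l)))"
      by (rule sum_mono)
    also have "\<dots> = 2 * card S"
      unfolding S_def
      by (subst card_SigmaI)
        (auto simp: sum_distrib_left finite_regular_graphs finite_lollipops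
          intro!: finite_SigmaI regular_graph.finite_switchings[OF reg])
    finally show ?thesis by (simp add: sum_distrib_right)
  qed
  also have "\<dots> \<le> 2 * (card ?R * (n * d ^ m * (Suc m * (d * d))))"
    using upper by simp
  also have "\<dots> = card ?R * (2 * d ^ Suc m * Suc m) * (n * d)"
    by (simp only: power_Suc mult_ac)
  finally have "?s * (n * d) \<le> card ?R * (2 * d ^ Suc m * Suc m) * (n * d)" .
  moreover have "n * d > 0" using d n by simp
  ultimately show ?thesis
    using mult_le_cancel2 by blast
qed

section \<open>The number of bad vertices\<close>

lemma card_bad_vertices: "card (bad_vertices n G M) \<le> (\<Sum>m\<le>M. card (lollipops n G m))"
proof -
  have "bad_vertices n G M \<subseteq> (\<Union>m\<le>M. (\<lambda>l. hd (fst l)) ` lollipops n G m)"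
  proof
    fix u assume "u \<in> bad_vertices n G M"
    then obtain m l where "m \<le> M" "l \<in> lollipops n G m" "u = hd (fst l)"
      unfolding bad_vertices_def by auto
    then show "u \<in> (\<Union>m\<le>M. (\<lambda>l. hd (fst l)) ` lollipops n G m)" by blast
  qed
  then have "card (bad_vertices n G M) \<le> card (\<Union>m\<le>M. (\<lambda>l. hd (fst l)) ` lollipops n G m)"
    by (intro card_mono) (auto simp: finite_lollipops)
  also have "\<dots> \<le> (\<Sum>m\<le>M. card ((\<lambda>l. hd (fst l)) ` lollipops n G m))"
    by (rule card_UN_le) simp
  also have "\<dots> \<le> (\<Sum>m\<le>M. card (lollipops n G m))"
    by (intro sum_mono card_image_le finite_lollipops)
  finally show ?thesis .
qed

text \<open>Markov's inequality: the mean is bounded independently of \<open>n\<close>. The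
  threshold sqrt n tends to infinity, so the probability vanishes, and is o(n), so the loss in the
  objective is negligible.\<close>

lemma few_bad_vertices:
  fixes n d M :: nat
  assumes d: "d > 0" and n: "2 * (M + 3 + 2 * d) \<le> n" and ne: "regular_graphs n d \<noteq> {}"
  shows "measure_pmf.prob (pmf_of_set (regular_graphs n d)) {G. real (card (bad_vertices n G M)) > sqrt n} \<le>
    (\<Sum>m\<le>M. 2 * real d ^ Suc m * Suc m) / sqrt n"
proof -
  let ?R = "regular_graphs n d" and ?K = "\<Sum>m\<le>M. 2 * d ^ Suc m * Suc m"
  let ?B = "?R \<inter> {G. real (card (bad_vertices n G M)) > sqrt n}"
  have n0: "real n > 0" using n d by simp
  have R0: "card ?R > 0" using ne finite_regular_graphs by (simp add: card_gt_0_iff)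
  have "(\<Sum>G\<in>?R. card (bad_vertices n G M)) \<le> (\<Sum>G\<in>?R. \<Sum>m\<le>M. card (lollipops n G m))"
    by (intro sum_mono card_bad_vertices)
  also have "\<dots> = (\<Sum>m\<le>M. \<Sum>G\<in>?R. card (lollipops n G m))"
    by (rule sum.swap)
  also have "\<dots> \<le> (\<Sum>m\<le>M. card ?R * (2 * d ^ Suc m * Suc m))"
    using n by (intro sum_mono sum_card_lollipops d) auto
  also have "\<dots> = card ?R * ?K" by (simp only: sum_distrib_left)
  finally have total: "(\<Sum>G\<in>?R. card (bad_vertices n G M)) \<le> card ?R * ?K" .
  have "card ?B * sqrt n = (\<Sum>G\<in>?B. sqrt n)" by simp
  also have "\<dots> \<le> (\<Sum>G\<in>?B. real (card (bad_vertices n G M)))"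
    by (intro sum_mono) auto
  also have "\<dots> \<le> (\<Sum>G\<in>?R. real (card (bad_vertices n G M)))"
    by (intro sum_mono2 finite_regular_graphs) auto
  also have "\<dots> \<le> card ?R * real ?K"
    using of_nat_mono[OF total, where 'a = real] by (simp only: of_nat_sum of_nat_mult)
  finally have *: "card ?B * sqrt n \<le> card ?R * real ?K" .
  have "a / r \<le> k / s" if "a * s \<le> r * k" "s > 0" "r > 0" for a r k s :: real
    using that by (simp add: field_simps)
  from this[OF *] have "card ?B / card ?R \<le> real ?K / sqrt n"
    using n0 R0 by simp
  moreover have "real ?K = (\<Sum>m\<le>M. 2 * real d ^ Suc m * Suc m)"
    by (simp only: of_nat_sum of_nat_mult of_nat_power of_nat_numeral)
  ultimately show ?thesis
    unfolding measure_pmf_of_set[OF ne finite_regular_graphs] by (simp only:)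
qed

section \<open>Pseudoexpectations from Gram matrices\<close>

lemma small_subsets_eq: "small_subsets {..<n::nat} = insert {} ((\<lambda>v. {v}) ` {..<n})"
proof -
  have "S = {} \<or> (\<exists>v. S = {v})" if "S \<subseteq> {..<n}" "card S \<le> 1" for S
  proof -
    have "finite S" using that(1) finite_subset by blast
    then show ?thesis
      using that(2) by (cases "card S = 0") (auto simp: card_1_singleton_iff le_Suc_eq)
  qed
  then show ?thesis
    unfolding small_subsets_def by (intro set_eqI iffI) auto
qed

lemma sum_small_subsets: "(\<Sum>S\<in>small_subsets {..<n::nat}. f S) = f {} + (\<Sum>v<n. f {v})"
  unfolding small_subsets_eq by (subst sum.insert) (auto simp: sum.reindex inj_on_def)

text \<open>The moment of the monomial of \<open>U\<close>; odd moments are set to 0.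
  \<open>Min\<close> and \<open>Max\<close> choose an order for the unordered pair, which is
  harmless as \<open>X\<close> will be symmetric.\<close>

definition gram_kernel :: "(nat \<Rightarrow> nat \<Rightarrow> real) \<Rightarrow> nat set \<Rightarrow> real" where
  "gram_kernel X U = (if U = {} then 1 else if card U = 2 then X (Min U) (Max U) else 0)"

definition gram_functional :: "nat \<Rightarrow> (nat \<Rightarrow> nat \<Rightarrow> real) \<Rightarrow> nat mlpoly \<Rightarrow> real" where
  "gram_functional n X r = (\<Sum>U\<in>Pow {..<n}. gram_kernel X U * r U)"

lemma gram_functional_monom:
  assumes "U \<subseteq> {..<n}"
  shows "gram_functional n X (mlmonom U) = gram_kernel X U"
  using assms unfolding gram_functional_def mlmonom_def
  by (simp add: if_distrib[of "\<lambda>x. _ * x"] cong: if_cong)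

lemma gram_functional_mlmult:
  "gram_functional n X (mlmult {..<n} p q) =
    (\<Sum>S\<in>Pow {..<n}. \<Sum>T\<in>Pow {..<n}. p S * q T * gram_kernel X (sym_diff S T))"
proof -
  let ?P = "Pow {..<n}"
  have "gram_functional n X (mlmult {..<n} p q) =
      (\<Sum>U\<in>?P. \<Sum>S\<in>?P. \<Sum>T\<in>?P. if sym_diff S T = U then p S * q T * gram_kernel X U else 0)"
    unfolding gram_functional_def mlmult_def sum_distrib_left
    by (intro sum.cong refl) (simp add: mult_ac)
  also have "\<dots> = (\<Sum>S\<in>?P. \<Sum>U\<in>?P. \<Sum>T\<in>?P. if sym_diff S T = U then p S * q T * gram_kernel X U else 0)"
    by (rule sum.swap)
  also have "\<dots> = (\<Sum>S\<in>?P. \<Sum>T\<in>?P. \<Sum>U\<in>?P. if sym_diff S T = U then p S * q T * gram_kernel X U else 0)"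
    by (intro sum.cong refl sum.swap)
  also have "\<dots> = (\<Sum>S\<in>?P. \<Sum>T\<in>?P. p S * q T * gram_kernel X (sym_diff S T))"
    by (intro sum.cong refl) (subst sum.delta', auto)
  finally show ?thesis .
qed

lemma gram_functional_mlmult_monom:
  assumes "S \<subseteq> {..<n}" "T \<subseteq> {..<n}"
  shows "gram_functional n X (mlmult {..<n} (mlmonom S) (mlmonom T)) = gram_kernel X (sym_diff S T)"
proof -
  let ?P = "Pow {..<n}"
  have "gram_functional n X (mlmult {..<n} (mlmonom S) (mlmonom T)) =
      (\<Sum>S'\<in>?P. \<Sum>T'\<in>?P. if S' = S then (if T' = T then gram_kernel X (sym_diff S' T') else 0) else 0)"
    unfolding gram_functional_mlmult mlmonom_def by (intro sum.cong refl) simp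
  also have "\<dots> = (\<Sum>S'\<in>?P. if S' = S then (\<Sum>T'\<in>?P. if T' = T then gram_kernel X (sym_diff S' T') else 0) else 0)"
    by (intro sum.cong refl) simp
  finally show ?thesis using assms by simp
qed

lemma gram_functional_quad_poly:
  "gram_functional n X (quad_poly {..<n} B) =
    (\<Sum>u<n. \<Sum>v<n. B u v * gram_kernel X (sym_diff {u} {v}))"
proof -
  let ?P = "Pow {..<n}" and ?m = "\<lambda>u v. mlmult {..<n} (mlmonom {u}) (mlmonom {v})"
  have "gram_functional n X (quad_poly {..<n} B) =
      (\<Sum>U\<in>?P. \<Sum>u<n. \<Sum>v<n. B u v * (gram_kernel X U * ?m u v U))"
    unfolding gram_functional_def quad_poly_def sum_distrib_left by (simp add: mult_ac)
  also have "\<dots> = (\<Sum>u<n. \<Sum>U\<in>?P. \<Sum>v<n. B u v * (gram_kernel X U * ?m u v U))"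
    by (rule sum.swap)
  also have "\<dots> = (\<Sum>u<n. \<Sum>v<n. \<Sum>U\<in>?P. B u v * (gram_kernel X U * ?m u v U))"
    by (intro sum.cong refl sum.swap)
  also have "\<dots> = (\<Sum>u<n. \<Sum>v<n. B u v * gram_functional n X (?m u v))"
    unfolding gram_functional_def sum_distrib_left ..
  finally show ?thesis
    by (simp add: gram_functional_mlmult_monom)
qed

locale gram_matrix =
  fixes n :: nat and X :: "nat \<Rightarrow> nat \<Rightarrow> real"
  assumes sym: "\<And>u v. u < n \<Longrightarrow> v < n \<Longrightarrow> X u v = X v u"
    and diag: "\<And>u. u < n \<Longrightarrow> X u u = 1"
    and psd: "\<And>f. qform n X f \<ge> 0"
begin

abbreviation "E \<equiv> gram_functional n X"

lemma kernel_pair: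
  assumes "u < n" "v < n"
  shows "gram_kernel X (sym_diff {u} {v}) = X u v"
proof (cases "u = v")
  case True
  then show ?thesis using diag[OF assms(1)] by (simp add: gram_kernel_def)
next
  case False
  then have "sym_diff {u} {v} = {u, v}" by auto
  then show ?thesis
    using False sym[OF assms] by (auto simp: gram_kernel_def min_def max_def)
qed

lemma kernel_single: "gram_kernel X {v} = 0"
  by (simp add: gram_kernel_def)

lemma pseudoexpectation: "pseudoexpectation2 {..<n} E"
  unfolding pseudoexpectation2_def
proof (intro conjI ballI allI)
  fix p q :: "nat mlpoly" and c
  show "E (\<lambda>S. p S + q S) = E p + E q"
    by (simp add: gram_functional_def distrib_left sum.distrib)
  show "E (\<lambda>S. c * p S) = c * E p"
    by (simp add: gram_functional_def sum_distrib_left mult_ac)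
next
  show "E (mlmonom {}) = 1"
    by (simp add: gram_functional_monom gram_kernel_def)
  show "E (mlmult {..<n} (mlmonom {v}) (mlmonom {v})) = 1" if "v \<in> {..<n}" for v
    using that by (simp add: gram_functional_mlmult_monom gram_kernel_def)
next
  fix p :: "nat mlpoly" assume p: "p \<in> mlpolys {..<n} 1"
  let ?s = "small_subsets {..<n}" and ?k = "\<lambda>S T. gram_kernel X (sym_diff S T)"
  have p0: "p S = 0" if "S \<in> Pow {..<n} - ?s" for S
    using p that by (auto simp: mlpolys_def small_subsets_def)
  have sub: "?s \<subseteq> Pow {..<n}" by (auto simp: small_subsets_def)
  have "E (mlmult {..<n} p p) = (\<Sum>S\<in>?s. \<Sum>T\<in>Pow {..<n}. p S * p T * ?k S T)"
    unfolding gram_functional_mlmult by (intro sum.mono_neutral_right sub) (auto simp: p0)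
  also have "\<dots> = (\<Sum>S\<in>?s. \<Sum>T\<in>?s. p S * p T * ?k S T)"
    by (intro sum.cong refl sum.mono_neutral_right sub) (auto simp: p0)
  \<comment> \<open>The mixed terms between {} and a singleton vanish because first moments are 0:
    the moment matrix is the direct sum of the 1 by 1 identity and \<open>X\<close>.\<close>
  also have "\<dots> = (p {})\<^sup>2 + (\<Sum>u<n. \<Sum>v<n. p {u} * p {v} * ?k {u} {v})"
    unfolding sum_small_subsets by (simp add: kernel_single power2_eq_square) (simp add: gram_kernel_def)
  also have "(\<Sum>u<n. \<Sum>v<n. p {u} * p {v} * ?k {u} {v}) = qform n X (\<lambda>u. p {u})"
    unfolding qform_def by (intro sum.cong refl) (simp add: kernel_pair del: Un_insert_left Un_insert_right)
  finally show "E (mlmult {..<n} p p) \<ge> 0"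
    using psd[of "\<lambda>u. p {u}"] by simp
qed

lemma objective: "E (quad_poly {..<n} B) = (\<Sum>u<n. \<Sum>v<n. B u v * X u v)"
  unfolding gram_functional_quad_poly
  by (intro sum.cong refl) (simp only: kernel_pair lessThan_iff)

lemma moments:
  "pseudomoment_matrix E {} {} = 1"
  "v < n \<Longrightarrow> pseudomoment_matrix E {} {v} = 0"
  "v < n \<Longrightarrow> pseudomoment_matrix E {v} {} = 0"
  "u < n \<Longrightarrow> v < n \<Longrightarrow> pseudomoment_matrix E {u} {v} = X u v"
proof -
  show "pseudomoment_matrix E {} {} = 1"
    by (simp add: pseudomoment_matrix_def gram_functional_monom gram_kernel_def)
  show "v < n \<Longrightarrow> pseudomoment_matrix E {} {v} = 0" "v < n \<Longrightarrow> pseudomoment_matrix E {v} {} = 0"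
    by (simp_all add: pseudomoment_matrix_def gram_functional_monom kernel_single)
  assume uv: "u < n" "v < n"
  then have "sym_diff {u} {v} \<subseteq> {..<n}" by auto
  then show "pseudomoment_matrix E {u} {v} = X u v"
    unfolding pseudomoment_matrix_def using gram_functional_monom kernel_pair[OF uv] by metis
qed

text \<open>The assumption \<open>g \<ge> 1\<close> accounts for the block at {}. A row of
  \<open>X\<close> is by symmetry a column, the image of a standard basis vector, so the contraction
  estimate bounds it as well.\<close>

lemma spectral_bounds:
  assumes g: "g \<ge> 1" and contr: "\<And>f. (\<Sum>u<n. (\<Sum>v<n. X u v * f v)\<^sup>2) \<le> g\<^sup>2 * (\<Sum>u<n. (f u)\<^sup>2)"
  shows "spectral_norm (small_subsets {..<n}) (pseudomoment_matrix E) \<le> g"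
    and "S \<in> small_subsets {..<n} \<Longrightarrow> L2_set (pseudomoment_matrix E S) (small_subsets {..<n}) \<le> g"
proof -
  let ?s = "small_subsets {..<n}" and ?M = "pseudomoment_matrix E"
  show "spectral_norm ?s ?M \<le> g"
    unfolding spectral_norm_def
  proof (rule cSUP_least)
    show "{f. L2_set f ?s \<le> 1} \<noteq> {}"
      by (auto intro!: exI[of _ "\<lambda>_. 0"] simp: L2_set_def)
    fix f assume f: "f \<in> {f. L2_set f ?s \<le> 1}"
    have "(\<Sum>S\<in>?s. (\<Sum>T\<in>?s. ?M S T * f T)\<^sup>2) = (f {})\<^sup>2 + (\<Sum>u<n. (\<Sum>v<n. X u v * f {v})\<^sup>2)"
      unfolding sum_small_subsets by (simp add: moments)
    also have "\<dots> \<le> g\<^sup>2 * (f {})\<^sup>2 + g\<^sup>2 * (\<Sum>u<n. (f {u})\<^sup>2)"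
      using contr[of "\<lambda>u. f {u}"] mult_right_mono[of 1 "g\<^sup>2" "(f {})\<^sup>2"] g by (simp add: one_le_power)
    also have "\<dots> = g\<^sup>2 * (\<Sum>S\<in>?s. (f S)\<^sup>2)"
      unfolding sum_small_subsets by (simp add: distrib_left)
    finally have "L2_set (\<lambda>S. \<Sum>T\<in>?s. ?M S T * f T) ?s \<le> sqrt (g\<^sup>2 * (\<Sum>S\<in>?s. (f S)\<^sup>2))"
      unfolding L2_set_def by (rule real_sqrt_le_mono)
    also have "\<dots> = g * L2_set f ?s"
      using g by (simp add: real_sqrt_mult L2_set_def)
    also have "\<dots> \<le> g * 1"
      using f g by (intro mult_left_mono) auto
    finally show "L2_set (\<lambda>S. \<Sum>T\<in>?s. ?M S T * f T) ?s \<le> g" by simp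
  qed
  assume "S \<in> ?s"
  then consider "S = {}" | u where "S = {u}" "u < n"
    unfolding small_subsets_eq by auto
  then show "L2_set (?M S) ?s \<le> g"
  proof cases
    case 1
    then show ?thesis
      unfolding L2_set_def sum_small_subsets using g by (simp add: moments)
  next
    case (2 u)
    have "(\<Sum>S'\<in>?s. (?M S S')\<^sup>2) = (\<Sum>v<n. (X u v)\<^sup>2)"
      unfolding sum_small_subsets 2 using 2(2) by (simp add: moments)
    also have "\<dots> = (\<Sum>v<n. (X v u)\<^sup>2)"
      using 2(2) by (intro sum.cong refl) (simp add: sym[of u])
    also have "\<dots> = (\<Sum>v<n. (\<Sum>w<n. X v w * of_bool (w = u))\<^sup>2)"
      using 2(2) by (simp add: of_bool_def if_distrib[of "\<lambda>x. _ * x"] cong: if_cong)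
    also have "\<dots> \<le> g\<^sup>2 * (\<Sum>v<n. (of_bool (v = u))\<^sup>2)"
      by (rule contr)
    also have "(\<Sum>v<n. (of_bool (v = u))\<^sup>2) = (1::real)"
      using 2(2) by (simp add: of_bool_def if_distrib[of "\<lambda>x. x ^ _"] cong: if_cong)
    finally have "L2_set (?M S) ?s \<le> sqrt (g\<^sup>2)"
      unfolding L2_set_def by (intro real_sqrt_le_mono) simp
    then show ?thesis using g by simp
  qed
qed

lemma entry_bound:
  assumes b: "0 \<le> b" and off: "\<And>u v. u < n \<Longrightarrow> v < n \<Longrightarrow> u \<noteq> v \<Longrightarrow> \<bar>X u v\<bar> \<le> b"
    and "S \<in> small_subsets {..<n}" "T \<in> small_subsets {..<n}" "S \<noteq> T"
  shows "\<bar>pseudomoment_matrix E S T\<bar> \<le> b"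
  using assms(3-5) b unfolding small_subsets_eq by (auto simp: moments off)

end

section \<open>The pseudoexpectation of a random regular graph\<close>

context regular_graph
begin

text \<open>The deterministic half: all randomness has gone into the bound \<open>b\<close>.
  \<open>M\<close> covers both 2 deg p, for the off-diagonal entries, and deg p + 1, for the
  diagonal of A p(A), even if \<open>p\<close> is constant.\<close>

lemma good_vertices_pseudoexpectation:
  fixes \<epsilon> m b :: real
  assumes d: "d \<ge> 3" and p: "p \<in> bernstein_cone d" "1 - p \<in> bernstein_cone d"
    and m: "0 < m" "m \<le> km d (poly p)"
    and eps: "0 < \<epsilon>" "\<epsilon> \<le> 1 / 2"
    and obj: "(1 - 2 * \<epsilon>) * (2 * sqrt (real d - 1)) * km d (poly p) \<le> - km d (poly ([:0, 1:] * p))"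
    and M: "M = 2 * degree p + 1" and bad: "real (card (bad_vertices n G M)) \<le> b"
  shows "\<exists>E. pseudoexpectation2 {..<n} E \<and>
    (1 - 2 * \<epsilon>) * (2 * sqrt (real d - 1)) * n - (2 * sqrt (real d - 1) + d / m) * b \<le>
      E (quad_poly {..<n} (\<lambda>u v. - adj_matrix G u v)) \<and>
    (\<forall>S\<in>small_subsets {..<n}. L2_set (pseudomoment_matrix E S) (small_subsets {..<n}) \<le> 1 / m) \<and>
    spectral_norm (small_subsets {..<n}) (pseudomoment_matrix E) \<le> 1 / m \<and>
    (\<forall>S\<in>small_subsets {..<n}. \<forall>T\<in>small_subsets {..<n}. S \<noteq> T \<longrightarrow>
      \<bar>pseudomoment_matrix E S T\<bar> \<le> (1 / m) / sqrt (real d))"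
proof -
  define A where "A = adj_matrix G"
  define P where "P = pmat n A p"
  define B where "B = bad_vertices n G M"
  define c where "c = km d (poly p)"
  define \<rho> where "\<rho> = 2 * sqrt (real d - 1)"
  \<comment> \<open>The identity on \<open>B\<close> plus the compression of P / c to the good
    vertices; the diagonal of the latter is 1 because \<open>P u u\<close> = c at every good
    vertex.\<close>
  define X where "X u v = (if u = v then 1 else if u \<in> B \<or> v \<in> B then 0 else P u v / c)" for u v
  have d': "real d \<ge> 3" using d by simp
  have A_sym: "\<And>u v. A u v = A v u" unfolding A_def by (rule adj_matrix_sym)
  have plus: "qform n (pmat n A [:real d, 1:]) f \<ge> 0" and minus: "qform n (pmat n A [:real d, -1:]) f \<ge> 0" for f
    unfolding A_def by (intro qform_degree_nonneg; simp)+
  have d_pos: "real d > 0" using d by simp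
  have P_sym: "P u v = P v u" if "u < n" "v < n" for u v
    unfolding P_def using that by (intro pmat_sym A_sym)
  have psd_P: "qform n P f \<ge> 0" for f
    unfolding P_def by (rule bernstein_cone_psd[OF A_sym d_pos plus minus p(1)])
  have contr_P: "(\<Sum>u<n. (\<Sum>v<n. P u v * f v)\<^sup>2) \<le> (\<Sum>u<n. (f u)\<^sup>2)" for f
    unfolding P_def by (rule bernstein_cone_contraction[OF A_sym d_pos plus minus p])
  have p01: "0 \<le> poly p x \<and> poly p x \<le> 1" if "\<bar>x\<bar> \<le> real d" for x
    using bernstein_cone_poly_nonneg[OF p(1) that] bernstein_cone_poly_nonneg[OF p(2) that] by simp
  have c: "m \<le> c" "0 < c" "c \<le> 1"
  proof -
    show "m \<le> c" "0 < c" using m by (auto simp: c_def)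
    have "km d (poly p) \<le> km d (poly 1)"
      by (intro km_mono d' continuous_intros) (use p01 in auto)
    then show "c \<le> 1" by (simp only: c_def km_1[OF d'])
  qed
  have P_diag: "P u u = c" if "u < n" "u \<notin> B" for u
    using pmat_good_diagonal[OF d, of u M p] that M by (simp add: P_def A_def B_def c_def)
  have P_entry: "\<bar>P u v\<bar> \<le> 1 / sqrt d" if "u < n" "u \<notin> B" "v < n" "u \<noteq> v" for u v
    using pmat_good_entry_bound[OF d, of u M v p] that M p01 by (simp add: P_def A_def B_def)
  have X_eq: "X u v = (if u = v \<and> u \<in> B then 1 else 0) + of_bool (u \<notin> B) * P u v * of_bool (v \<notin> B) / c"
    if "u < n" for u v
    using P_diag[OF that] c by (auto simp: X_def)
  have X_apply: "(\<Sum>v<n. X u v * f v) = (if u \<in> B then f u else (\<Sum>v<n. P u v * (of_bool (v \<notin> B) * f v)) / c)"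
    if "u < n" for u f
  proof (cases "u \<in> B")
    case True
    then have "(\<Sum>v<n. X u v * f v) = (\<Sum>v<n. if u = v then f v else 0)"
      by (intro sum.cong refl) (simp add: X_def)
    then show ?thesis using True that by simp
  next
    case False
    then have "(\<Sum>v<n. X u v * f v) = (\<Sum>v<n. P u v * (of_bool (v \<notin> B) * f v) / c)"
      using that by (intro sum.cong refl) (simp add: X_eq)
    then show ?thesis using False by (simp add: sum_divide_distrib)
  qed
  interpret gram_matrix n X
  proof
    fix u v assume "u < n" "v < n"
    then show "X u v = X v u"
      using P_sym[of u v] by (simp add: X_def)
  next
    fix u show "X u u = 1" by (simp add: X_def)
  next
    fix f :: "nat \<Rightarrow> real"
    let ?g = "\<lambda>u. of_bool (u \<notin> B) * f u"
    have "qform n X f = (\<Sum>u<n. (if u \<in> B then (f u)\<^sup>2 else 0) + ?g u * (\<Sum>v<n. P u v * ?g v) / c)"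
      unfolding qform_eq by (intro sum.cong refl) (simp add: X_apply power2_eq_square)
    also have "\<dots> = (\<Sum>u<n. if u \<in> B then (f u)\<^sup>2 else 0) + qform n P ?g / c"
      unfolding qform_eq by (simp only: sum.distrib sum_divide_distrib)
    also have "\<dots> \<ge> 0"
      using psd_P[of ?g] c by (intro add_nonneg_nonneg sum_nonneg) auto
    finally show "qform n X f \<ge> 0" .
  qed
  have contr_X: "(\<Sum>u<n. (\<Sum>v<n. X u v * f v)\<^sup>2) \<le> (1 / m)\<^sup>2 * (\<Sum>u<n. (f u)\<^sup>2)" for f
  proof -
    let ?g = "\<lambda>u. of_bool (u \<notin> B) * f u"
    have "(\<Sum>u<n. (\<Sum>v<n. X u v * f v)\<^sup>2) \<le> (\<Sum>u<n. (if u \<in> B then (f u)\<^sup>2 else 0) + (\<Sum>v<n. P u v * ?g v)\<^sup>2 / c\<^sup>2)"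
      by (intro sum_mono) (simp add: X_apply power_divide)
    also have "\<dots> = (\<Sum>u<n. if u \<in> B then (f u)\<^sup>2 else 0) + (\<Sum>u<n. (\<Sum>v<n. P u v * ?g v)\<^sup>2) / c\<^sup>2"
      by (simp only: sum.distrib sum_divide_distrib)
    also have "\<dots> \<le> (\<Sum>u<n. if u \<in> B then (f u)\<^sup>2 else 0) / c\<^sup>2 + (\<Sum>u<n. (?g u)\<^sup>2) / c\<^sup>2"
    proof (intro add_mono divide_right_mono contr_P)
      \<comment> \<open>As c \<le> 1, the identity block obeys the same bound 1 / c as the other
        block.\<close>
      have "0 \<le> (\<Sum>u<n. if u \<in> B then (f u)\<^sup>2 else 0)" by (intro sum_nonneg) auto
      moreover have "c\<^sup>2 \<le> 1" "0 < c\<^sup>2" using c by (auto simp: power_le_one)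
      ultimately show "(\<Sum>u<n. if u \<in> B then (f u)\<^sup>2 else 0) \<le> (\<Sum>u<n. if u \<in> B then (f u)\<^sup>2 else 0) / c\<^sup>2"
        by (simp add: pos_le_divide_eq mult_left_le)
    qed simp
    also have "\<dots> = (\<Sum>u<n. (f u)\<^sup>2) / c\<^sup>2"
      unfolding add_divide_distrib[symmetric] sum.distrib[symmetric]
      by (intro arg_cong[where f = "\<lambda>x. x / _"] sum.cong refl) simp
    also have "\<dots> \<le> (\<Sum>u<n. (f u)\<^sup>2) / m\<^sup>2"
      using c m by (intro divide_left_mono sum_nonneg power_mono) auto
    finally show ?thesis by (simp add: power_divide)
  qed
  have m1: "1 \<le> 1 / m" using c m by simp
  have off: "\<bar>X u v\<bar> \<le> (1 / m) / sqrt d" if "u < n" "v < n" "u \<noteq> v" for u v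
  proof (cases "u \<in> B \<or> v \<in> B")
    case True
    then show ?thesis using that m by (simp add: X_def)
  next
    case False
    then have "\<bar>X u v\<bar> = \<bar>P u v\<bar> / c" using that c by (simp add: X_def)
    also have "\<dots> \<le> (1 / sqrt d) / m"
      using P_entry[of u v] that False c m by (intro frac_le) auto
    finally show ?thesis by (simp add: mult.commute)
  qed
  have "(1 - 2 * \<epsilon>) * \<rho> * n - (\<rho> + d / m) * b \<le> (\<Sum>u<n. \<Sum>v<n. - A u v * X u v)"
  proof -
    have B: "B \<subseteq> {..<n}" "finite B"
      by (auto simp: B_def bad_vertices_def)
    have A_diag: "A u u = 0" for u
      using edge_props(3)[of u u] by (auto simp: A_def adj_matrix_def)
    have A01: "0 \<le> A u v" "A u v \<le> 1" for u v
      by (auto simp: A_def adj_matrix_def)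
    have deg: "(\<Sum>v<n. A u v) = d" if "u < n" for u
      using sum_adj[of u "\<lambda>_. 1"] card_nbrs[OF that] by (simp add: A_def)
    have row: "(1 - 2 * \<epsilon>) * \<rho> - (\<Sum>v\<in>B. A u v) / c \<le> (\<Sum>v<n. - A u v * X u v)"
      if u: "u < n" "u \<notin> B" for u
    proof -
      have "(\<Sum>v<n. A u v * P v u) = km d (poly ([:0, 1:] * p))"
      proof -
        have "(\<Sum>v<n. A u v * P v u) = pmat n A ([:0, 1:] * p) u u"
          by (simp add: P_def pmat_pCons)
        also have "degree ([:0, 1:] * p) \<le> M"
          using degree_mult_le[of "[:0, 1:]" p] M by simp
        then have "pmat n A ([:0, 1:] * p) u u = km d (poly ([:0, 1:] * p))"
          unfolding A_def using u by (intro pmat_good_diagonal d) (auto simp: B_def)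
        finally show ?thesis .
      qed
      also have "(\<Sum>v<n. A u v * P v u) = (\<Sum>v<n. A u v * P u v)"
        using u P_sym[of u] by (intro sum.cong refl) simp
      finally have AP: "(\<Sum>v<n. A u v * P u v) = km d (poly ([:0, 1:] * p))" .
      \<comment> \<open>At a bad neighbour the entry \<open>P u v\<close> / c is replaced by 0.
        Since |P u v| \<le> 1 in a good row, this costs at most \<open>A u v\<close> / c.\<close>
      have summand: "- A u v * P u v / c - of_bool (v \<in> B) * A u v / c \<le> - A u v * X u v" if v: "v < n" for v
      proof (cases "u = v")
        case True
        then show ?thesis by (simp add: A_diag)
      next
        case False
        show ?thesis
        proof (cases "v \<in> B")
          case True
          have "\<bar>P u v\<bar> \<le> 1 / sqrt d" using P_entry u v False by simp
          also have "\<dots> \<le> 1" using d' by simp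
          finally have "A u v * (- P u v - 1) \<le> 0"
            using A01 by (intro mult_nonneg_nonpos) auto
          then have "A u v * (- P u v - 1) / c \<le> 0"
            using c by (simp add: divide_nonpos_pos)
          then show ?thesis
            using True False by (simp add: X_def right_diff_distrib diff_divide_distrib)
        next
          case False
          then show ?thesis using \<open>u \<noteq> v\<close> u by (simp add: X_def)
        qed
      qed
      have "(1 - 2 * \<epsilon>) * \<rho> \<le> - km d (poly ([:0, 1:] * p)) / c"
        using obj unfolding pos_le_divide_eq[OF c(2)] unfolding c_def \<rho>_def .
      moreover have "(\<Sum>v\<in>B. A u v) = (\<Sum>v<n. of_bool (v \<in> B) * A u v)"
        using B by (simp add: of_bool_def sum.If_cases if_distrib[of "\<lambda>x. x * _"] Int_absorb1 cong: if_cong)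
      ultimately have "(1 - 2 * \<epsilon>) * \<rho> - (\<Sum>v\<in>B. A u v) / c \<le>
          - (\<Sum>v<n. A u v * P u v) / c - (\<Sum>v<n. of_bool (v \<in> B) * A u v) / c"
        by (simp only: AP)
      also have "- (\<Sum>v<n. A u v * P u v) / c - (\<Sum>v<n. of_bool (v \<in> B) * A u v) / c =
          (\<Sum>v<n. - A u v * P u v / c - of_bool (v \<in> B) * A u v / c)"
        by (simp only: sum_subtractf sum_divide_distrib sum_negf[symmetric] mult_minus_left)
      also have "\<dots> \<le> (\<Sum>v<n. - A u v * X u v)"
        by (intro sum_mono summand) auto
      finally show ?thesis .
    qed
    have bad_row: "(\<Sum>v<n. - A u v * X u v) = 0" if "u \<in> B" for u
      using that by (intro sum.neutral) (auto simp: X_def A_diag)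
    have \<rho>: "\<rho> \<ge> 0" using d' by (simp add: \<rho>_def)
    \<comment> \<open>Each bad vertex loses its own row, worth at most \<rho>, and each of its at
      most d edges to good vertices loses at most 1 / c in the row of the good end.\<close>
    have "(1 - 2 * \<epsilon>) * \<rho> * n - (\<rho> + d / m) * b \<le> (1 - 2 * \<epsilon>) * \<rho> * n - (\<rho> + d / c) * card B"
    proof -
      have "(\<rho> + d / c) * card B \<le> (\<rho> + d / m) * b"
        using bad c m \<rho> by (intro mult_mono add_mono frac_le) (auto simp: B_def)
      then show ?thesis by simp
    qed
    also have "\<dots> \<le> (1 - 2 * \<epsilon>) * \<rho> * (real n - card B) - d * card B / c"
    proof -
      have "(1 - 2 * \<epsilon>) * (\<rho> * card B) \<le> 1 * (\<rho> * card B)"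
        using \<rho> eps by (intro mult_right_mono) auto
      then show ?thesis by (simp add: algebra_simps)
    qed
    also have "\<dots> \<le> (1 - 2 * \<epsilon>) * \<rho> * (real n - card B) - (\<Sum>u\<in>{..<n} - B. \<Sum>v\<in>B. A u v) / c"
    proof -
      have "(\<Sum>u\<in>{..<n} - B. \<Sum>v\<in>B. A u v) \<le> (\<Sum>u<n. \<Sum>v\<in>B. A u v)"
        using A01 by (intro sum_mono2 sum_nonneg) auto
      also have "\<dots> = (\<Sum>v\<in>B. \<Sum>u<n. A u v)" by (rule sum.swap)
      also have "\<dots> = (\<Sum>v\<in>B. \<Sum>u<n. A v u)" by (intro sum.cong refl A_sym)
      also have "\<dots> = (\<Sum>v\<in>B. real d)" using B by (intro sum.cong refl deg) auto
      finally show ?thesis using c by (simp add: divide_right_mono mult.commute)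
    qed
    also have "\<dots> = (\<Sum>u\<in>{..<n} - B. (1 - 2 * \<epsilon>) * \<rho> - (\<Sum>v\<in>B. A u v) / c)"
    proof -
      have "real (card ({..<n} - B)) = real n - card B"
        using B card_mono[of "{..<n}" B] by (simp add: card_Diff_subset of_nat_diff)
      then show ?thesis by (simp add: sum_subtractf sum_divide_distrib)
    qed
    also have "\<dots> \<le> (\<Sum>u\<in>{..<n} - B. \<Sum>v<n. - A u v * X u v)"
      by (intro sum_mono row) auto
    also have "\<dots> = (\<Sum>u<n. \<Sum>v<n. - A u v * X u v)"
      using bad_row by (intro sum.mono_neutral_left) auto
    finally show ?thesis .
  qed
  then have "(1 - 2 * \<epsilon>) * \<rho> * n - (\<rho> + d / m) * b \<le> gram_functional n X (quad_poly {..<n} (\<lambda>u v. - adj_matrix G u v))"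
    by (simp only: objective A_def)
  then show ?thesis
    using pseudoexpectation spectral_bounds[OF m1 contr_X] entry_bound[OF _ off] m
    unfolding \<rho>_def by (intro exI[of _ "gram_functional n X"]) auto
qed

end

section \<open>Passage to the limit\<close>

lemma sqrt_ratio_tendsto_0: "((\<lambda>n. K / sqrt (real n)) \<longlongrightarrow> 0) sequentially"
  by (rule real_tendsto_divide_at_top[OF tendsto_const])
    (intro filterlim_compose[OF sqrt_at_top filterlim_real_sequentially])

theorem theorem5p1:
  shows "\<forall>\<epsilon>::real. \<epsilon> > 0 \<longrightarrow>
    (\<exists>\<gamma> \<gamma>' \<gamma>'' :: real. \<gamma> > 0 \<and> \<gamma>' > 0 \<and> \<gamma>'' > 0 \<and>
      (\<forall>d::nat. d \<ge> 3 \<longrightarrow>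
        (\<exists>\<eta> :: nat \<Rightarrow> real.
          (\<eta> \<longlongrightarrow> 0) (inf sequentially (principal {n. even (d * n)})) \<and>
          ((\<lambda>n. measure_pmf.prob (pmf_of_set (regular_graphs n d))
              {G. \<exists>E. pseudoexpectation2 {..<n} E \<and>
                  E (quad_poly {..<n} (\<lambda>u v. - adj_matrix G u v))
                    \<ge> (1 - 2 * \<epsilon> - \<eta> n) * (2 * sqrt (real d - 1)) * real n \<and>
                  (\<forall>S\<in>small_subsets {..<n}.
                     L2_set (pseudomoment_matrix E S) (small_subsets {..<n}) \<le> \<gamma>) \<and>
                  spectral_norm (small_subsets {..<n}) (pseudomoment_matrix E) \<le> \<gamma>' \<and>
                  (\<forall>S\<in>small_subsets {..<n}. \<forall>T\<in>small_subsets {..<n}. S \<noteq> T \<longrightarrow>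
                     \<bar>pseudomoment_matrix E S T\<bar> \<le> \<gamma>'' / sqrt (real d))})
            \<longlongrightarrow> 1) (inf sequentially (principal {n. even (d * n)})))))"
proof (intro allI impI)
  fix \<epsilon> :: real assume "\<epsilon> > 0"
  \<comment> \<open>The construction works for \<epsilon> up to 1 / 2. For larger values the claim
    is weaker than the one at 1 / 2, whose constants then serve.\<close>
  define \<epsilon>' where "\<epsilon>' = min \<epsilon> (1 / 2)"
  have eps: "0 < \<epsilon>'" "\<epsilon>' \<le> 1 / 2" "\<epsilon>' < 1" "\<epsilon>' \<le> \<epsilon>"
    using \<open>\<epsilon> > 0\<close> by (auto simp: \<epsilon>'_def)
  obtain m where m: "m > 0" and test: "\<And>D. D \<ge> 3 \<Longrightarrow>
      \<exists>p. p \<in> bernstein_cone D \<and> 1 - p \<in> bernstein_cone D \<and> m \<le> km D (poly p) \<and>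
        (1 - 2 * \<epsilon>') * (2 * sqrt (D - 1)) * km D (poly p) \<le> - km D (poly ([:0, 1:] * p))"
    using test_polynomial[OF eps(1,3)] by blast
  show "\<exists>\<gamma> \<gamma>' \<gamma>'' :: real. \<gamma> > 0 \<and> \<gamma>' > 0 \<and> \<gamma>'' > 0 \<and>
      (\<forall>d::nat. d \<ge> 3 \<longrightarrow>
        (\<exists>\<eta> :: nat \<Rightarrow> real.
          (\<eta> \<longlongrightarrow> 0) (inf sequentially (principal {n. even (d * n)})) \<and>
          ((\<lambda>n. measure_pmf.prob (pmf_of_set (regular_graphs n d))
              {G. \<exists>E. pseudoexpectation2 {..<n} E \<and>
                  E (quad_poly {..<n} (\<lambda>u v. - adj_matrix G u v))
                    \<ge> (1 - 2 * \<epsilon> - \<eta> n) * (2 * sqrt (real d - 1)) * real n \<and>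
                  (\<forall>S\<in>small_subsets {..<n}.
                     L2_set (pseudomoment_matrix E S) (small_subsets {..<n}) \<le> \<gamma>) \<and>
                  spectral_norm (small_subsets {..<n}) (pseudomoment_matrix E) \<le> \<gamma>' \<and>
                  (\<forall>S\<in>small_subsets {..<n}. \<forall>T\<in>small_subsets {..<n}. S \<noteq> T \<longrightarrow>
                     \<bar>pseudomoment_matrix E S T\<bar> \<le> \<gamma>'' / sqrt (real d))})
            \<longlongrightarrow> 1) (inf sequentially (principal {n. even (d * n)}))))"
  proof (rule exI[of _ "1 / m"], rule exI[of _ "1 / m"], rule exI[of _ "1 / m"], intro conjI allI impI)
    show "1 / m > 0" "1 / m > 0" "1 / m > 0" using m by auto
  next
    fix d :: nat assume d: "d \<ge> 3"
    define \<rho> where "\<rho> = 2 * sqrt (real d - 1)"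
    have \<rho>: "\<rho> > 0" using d by (simp add: \<rho>_def)
    have "real d \<ge> 3" using d by simp
    from test[OF this] obtain p where p: "p \<in> bernstein_cone d" "1 - p \<in> bernstein_cone d"
      "m \<le> km d (poly p)" "(1 - 2 * \<epsilon>') * (2 * sqrt (real d - 1)) * km d (poly p) \<le> - km d (poly ([:0, 1:] * p))"
      by blast
    define M where "M = 2 * degree p + 1"
    \<comment> \<open>The loss (\<rho> + d / m) sqrt n from at most sqrt n bad vertices, relative to
      \<rho> n.\<close>
    define \<eta> where "\<eta> n = (\<rho> + d / m) / \<rho> / sqrt (real n)" for n :: nat
    define K where "K = (\<Sum>m\<le>M. 2 * real d ^ Suc m * Suc m)"
    let ?F = "inf sequentially (principal {n. even (d * n)})"
    let ?good = "\<lambda>n. {G. \<exists>E. pseudoexpectation2 {..<n} E \<and>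
                  E (quad_poly {..<n} (\<lambda>u v. - adj_matrix G u v))
                    \<ge> (1 - 2 * \<epsilon> - \<eta> n) * (2 * sqrt (real d - 1)) * real n \<and>
                  (\<forall>S\<in>small_subsets {..<n}.
                     L2_set (pseudomoment_matrix E S) (small_subsets {..<n}) \<le> 1 / m) \<and>
                  spectral_norm (small_subsets {..<n}) (pseudomoment_matrix E) \<le> 1 / m \<and>
                  (\<forall>S\<in>small_subsets {..<n}. \<forall>T\<in>small_subsets {..<n}. S \<noteq> T \<longrightarrow>
                     \<bar>pseudomoment_matrix E S T\<bar> \<le> (1 / m) / sqrt (real d))}"
    let ?pr = "\<lambda>n. measure_pmf.prob (pmf_of_set (regular_graphs n d)) (?good n)"
    have good: "G \<in> ?good n"
      if G: "G \<in> regular_graphs n d" and n: "n > 0" and few: "real (card (bad_vertices n G M)) \<le> sqrt n" for n G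
    proof -
      interpret regular_graph n d G using G by unfold_locales
      have "(1 - 2 * \<epsilon> - \<eta> n) * \<rho> * n \<le> (1 - 2 * \<epsilon>') * \<rho> * n - (\<rho> + d / m) * sqrt n"
      proof -
        have "\<eta> n * \<rho> * n = (\<rho> + d / m) * (real n / sqrt n)"
          using \<rho> by (simp add: \<eta>_def)
        also have "real n / sqrt n = sqrt n" using n by (simp add: real_div_sqrt)
        finally have "\<eta> n * \<rho> * n = (\<rho> + d / m) * sqrt n" .
        moreover have "(1 - 2 * \<epsilon>) * (\<rho> * n) \<le> (1 - 2 * \<epsilon>') * (\<rho> * n)"
          using eps \<rho> by (intro mult_right_mono) auto
        ultimately show ?thesis by (simp add: algebra_simps)
      qed
      then show ?thesis
        using good_vertices_pseudoexpectation[OF d p(1,2) m p(3) eps(1,2) p(4) M_def few]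
        unfolding \<rho>_def by (blast intro: order_trans)
    qed
    have lower: "eventually (\<lambda>n. 1 - K / sqrt n \<le> ?pr n) ?F"
    proof -
      have "1 - K / sqrt n \<le> ?pr n" if n: "n \<ge> 2 * (M + 3 + 2 * d)" and even: "even (d * n)" for n
      proof -
        have ne: "regular_graphs n d \<noteq> {}"
          using n even d by (intro regular_graphs_nonempty) auto
        let ?\<mu> = "pmf_of_set (regular_graphs n d)"
        let ?bad = "{G. real (card (bad_vertices n G M)) > sqrt n}"
        have "1 - K / sqrt n \<le> 1 - measure_pmf.prob ?\<mu> ?bad"
          using few_bad_vertices[OF _ n ne] d by (simp add: K_def)
        also have "\<dots> = measure_pmf.prob ?\<mu> (- ?bad)"
          using measure_pmf.prob_compl[of ?bad ?\<mu>] by (simp add: Compl_eq_Diff_UNIV)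
        also have "\<dots> = measure_pmf.prob ?\<mu> (- ?bad \<inter> regular_graphs n d)"
          using measure_Int_set_pmf[of ?\<mu> "- ?bad"] set_pmf_of_set[OF ne finite_regular_graphs] by simp
        also have "\<dots> \<le> ?pr n"
          using good n d by (intro measure_pmf.finite_measure_mono) auto
        finally show ?thesis .
      qed
      then show ?thesis
        unfolding eventually_inf_principal
        by (intro eventually_sequentiallyI[of "2 * (M + 3 + 2 * d)"]) auto
    qed
    have "(\<eta> \<longlongrightarrow> 0) ?F"
      unfolding \<eta>_def by (rule tendsto_mono[OF inf_le1 sqrt_ratio_tendsto_0])
    moreover have "(?pr \<longlongrightarrow> 1) ?F"
    proof (rule tendsto_sandwich[OF lower])
      show "eventually (\<lambda>n. ?pr n \<le> 1) ?F" by simp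
      have "((\<lambda>n. 1 - K / sqrt (real n)) \<longlongrightarrow> 1 - 0) sequentially"
        by (intro tendsto_diff tendsto_const sqrt_ratio_tendsto_0)
      then show "((\<lambda>n. 1 - K / sqrt (real n)) \<longlongrightarrow> 1) ?F"
        using tendsto_mono[OF inf_le1] by force
    qed simp
    ultimately show "\<exists>\<eta> :: nat \<Rightarrow> real. (\<eta> \<longlongrightarrow> 0) ?F \<and>
          ((\<lambda>n. measure_pmf.prob (pmf_of_set (regular_graphs n d))
              {G. \<exists>E. pseudoexpectation2 {..<n} E \<and>
                  E (quad_poly {..<n} (\<lambda>u v. - adj_matrix G u v))
                    \<ge> (1 - 2 * \<epsilon> - \<eta> n) * (2 * sqrt (real d - 1)) * real n \<and>
                  (\<forall>S\<in>small_subsets {..<n}.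
                     L2_set (pseudomoment_matrix E S) (small_subsets {..<n}) \<le> 1 / m) \<and>
                  spectral_norm (small_subsets {..<n}) (pseudomoment_matrix E) \<le> 1 / m \<and>
                  (\<forall>S\<in>small_subsets {..<n}. \<forall>T\<in>small_subsets {..<n}. S \<noteq> T \<longrightarrow>
                     \<bar>pseudomoment_matrix E S T\<bar> \<le> (1 / m) / sqrt (real d))}) \<longlongrightarrow> 1) ?F"
      by blast
  qed
qed

end
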